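(* Let $n,N\ge1$, $q,v\in\mathbb{C}^*$. For any non-zero complex numbers $u_0,\dots,u_{n-1}$ and any $n_{tw}\in\mathbb{Z}$ there is an action of the double affine Hecke algebra $\mathcal{H}_N$ on $(\mathbb{C}^n)^{\otimes N}[Y_1^{\pm1},\dots,Y_N^{\pm1}]$ determined by the following conditions: the generators $Y_i^{\pm1}$ act by multiplication, the generators $T_i$ act by $$T_i=s_i^YR_{i,i+1}+(v-v^{-1})\frac{s_i^Y-1}{Y_i/Y_{i+1}-1},$$ and $\pi$ acts by $\pi=\kappa_1^{n_{tw}}D_1s_1\cdots s_{N-1}$.
   Context: $\mathcal{H}_N$ is the algebra with generators $T_1,\dots,T_{N-1},\pi^{\pm1},Y_1^{\pm1},\dots,Y_N^{\pm1}$ and relations: $(T_i-v)(T_i+v^{-1})=0$; $T_iT_{i+1}T_i=T_{i+1}T_iT_{i+1}$; $T_iT_j=T_jT_i$ for $|i-j|>1$; $T_iY_iT_i=Y_{i+1}$; $T_iY_j=Y_jT_i$ for $j\ne i,i+1$; $Y_iY_j=Y_jY_i$; $\pi Y_i\pi^{-1}=q^{\delta_{i,N}}Y_{i+1}$ with $Y_{N+1}:=Y_1$; $\pi T_i\pi^{-1}=T_{i+1}$ ($1\le i\le N-2$); $\pi^NT_i=T_i\pi^N$. $\mathbb{C}^n$ has basis $e_0,\dots,e_{n-1}$; in $\mathbb{C}^n[Y^{\pm1}]$ put $e_{nj+a}=Y^je_a$ ($j\in\mathbb{Z}$, $0\le a<n$). Identify $(\mathbb{C}^n[Y^{\pm1}])^{\otimes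 N}$ with $(\mathbb{C}^n)^{\otimes N}[Y_1^{\pm1},\dots,Y_N^{\pm1}]$, where $Y_i$ is $Y$ in the $i$-th factor. $R=v\sum_aE_{aa}\otimes E_{aa}+\sum_{a<b}\big(E_{ab}\otimes E_{ba}+E_{ba}\otimes E_{ab}+(v-v^{-1})E_{aa}\otimes E_{bb}\big)$ acts on $\mathbb{C}^n\otimes\mathbb{C}^n$ ($E_{ab}$ are matrix units), and $R_{i,i+1}$ is $R$ acting on the $i$-th and $(i+1)$-st factors $\mathbb{C}^n$. $s_i^Y$ swaps the variables $Y_i$ and $Y_{i+1}$ and does not touch the factors $\mathbb{C}^n$; $s_i$ swaps the $i$-th and $(i+1)$-st tensor factors of $(\mathbb{C}^n[Y^{\pm1}])^{\otimes N}$. Operators on $\mathbb{C}^n[Y^{\pm1}]$: $\kappa e_i=e_{i-1}$ ($i\in\mathbb{Z}$), $D(Y^je_a)=u_aq^jY^je_a$ ($0\le a<n$); $\kappa_i,D_i$ denote these acting on the $i$-th tensor factor. *)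

theory Defs
  imports
    "HOL-Algebra.QuotRing"
    "HOL-Library.Poly_Mapping"
    "HOL-Library.FuncSet"
    "HOL-Combinatorics.Transposition"
    Complex_Main
begin

datatype daha_gen = GT nat | GPi | GPiInv | GY nat | GYInv nat

definition daha_gens :: "nat \<Rightarrow> daha_gen set" where
  "daha_gens N = GT ` {1..<N} \<union> {GPi, GPiInv} \<union> GY ` {1..N} \<union> GYInv ` {1..N}"

text \<open>Words form a monoid, written additively because the convolution product of
  \<^typ>\<open>'a \<Rightarrow>\<^sub>0 'b\<close> is taken over an additive monoid of keys. Hence
  \<open>daha_gen word \<Rightarrow>\<^sub>0 complex\<close> is the free associative algebra on \<open>daha_gen\<close>.\<close>

datatype 'a word = Word (letters: "'a list")

instantiation word :: (type) monoid_add
begin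
definition zero_word :: "'a word" where "zero_word = Word []"
definition plus_word :: "'a word \<Rightarrow> 'a word \<Rightarrow> 'a word" where
  "plus_word x y = Word (letters x @ letters y)"
instance by standard (auto simp: zero_word_def plus_word_def)
end

type_synonym free_elt = "daha_gen word \<Rightarrow>\<^sub>0 complex"

definition free_alg :: "nat \<Rightarrow> free_elt ring" where
  "free_alg N = \<lparr>carrier = {p. \<forall>w \<in> Poly_Mapping.keys p. set (letters w) \<subseteq> daha_gens N},
     mult = (*), one = 1, zero = 0, add = (+)\<rparr>"

definition gen :: "daha_gen \<Rightarrow> free_elt" where
  "gen g = Poly_Mapping.single (Word [g]) 1"

definition const :: "complex \<Rightarrow> free_elt" where
  "const c = Poly_Mapping.single 0 c"

abbreviation "T i \<equiv> gen (GT i)"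
abbreviation "Y i \<equiv> gen (GY i)"
abbreviation "Yinv i \<equiv> gen (GYInv i)"
abbreviation "Pi_gen \<equiv> gen GPi"
abbreviation "Pi_inv \<equiv> gen GPiInv"

text \<open>A relation \<open>a = b\<close> is recorded as the element \<open>a - b\<close>.\<close>

definition daha_rels :: "nat \<Rightarrow> complex \<Rightarrow> complex \<Rightarrow> free_elt set" where
  "daha_rels N q v =
     {Pi_gen * Pi_inv - 1, Pi_inv * Pi_gen - 1}
   \<union> {Y i * Yinv i - 1 | i. i \<in> {1..N}}
   \<union> {Yinv i * Y i - 1 | i. i \<in> {1..N}}
   \<union> {(T i - const v) * (T i + const (inverse v)) | i. i \<in> {1..<N}}
   \<union> {T i * T (i+1) * T i - T (i+1) * T i * T (i+1) | i. i \<in> {1..<N} \<and> i + 1 \<in> {1..<N}}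
   \<union> {T i * T j - T j * T i | i j. i \<in> {1..<N} \<and> j \<in> {1..<N} \<and> \<bar>int i - int j\<bar> > 1}
   \<union> {T i * Y i * T i - Y (i+1) | i. i \<in> {1..<N}}
   \<union> {T i * Y j - Y j * T i | i j. i \<in> {1..<N} \<and> j \<in> {1..N} \<and> j \<noteq> i \<and> j \<noteq> i + 1}
   \<union> {Y i * Y j - Y j * Y i | i j. i \<in> {1..N} \<and> j \<in> {1..N}}
   \<union> {Pi_gen * Y i * Pi_inv - const (if i = N then q else 1) * Y (if i = N then 1 else i + 1)
        | i. i \<in> {1..N}}
   \<union> {Pi_gen * T i * Pi_inv - T (i+1) | i. 1 \<le> i \<and> i + 2 \<le> N}
   \<union> {Pi_gen ^ N * T i - T i * Pi_gen ^ N | i. i \<in> {1..<N}}"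

definition daha_ideal :: "nat \<Rightarrow> complex \<Rightarrow> complex \<Rightarrow> free_elt set" where
  "daha_ideal N q v = genideal (free_alg N) (daha_rels N q v)"

definition daha :: "nat \<Rightarrow> complex \<Rightarrow> complex \<Rightarrow> free_elt set ring" where
  "daha N q v = free_alg N Quot daha_ideal N q v"

definition daha_class :: "nat \<Rightarrow> complex \<Rightarrow> complex \<Rightarrow> free_elt \<Rightarrow> free_elt set" where
  "daha_class N q v p = daha_ideal N q v +>\<^bsub>free_alg N\<^esub> p"

text \<open>The key \<open>(m, c)\<close> stands for the basis vector
  \<open>Y\<^sub>1^(m 1) \<cdots> Y\<^sub>N^(m N) \<cdot> e\<^bsub>c 1\<^esub> \<otimes> \<cdots> \<otimes> e\<^bsub>c N\<^esub>\<close>,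
  that is, for the tensor product of the \<open>Y^(m i) e\<^bsub>c i\<^esub>\<close>. Keys vanish off
  \<open>{1..N}\<close>, so that each basis vector has exactly one key.\<close>

type_synonym key = "(nat \<Rightarrow> int) \<times> (nat \<Rightarrow> nat)"
type_synonym vec = "key \<Rightarrow>\<^sub>0 complex"

definition basis_keys :: "nat \<Rightarrow> nat \<Rightarrow> key set" where
  "basis_keys n N = {(m, c). (\<forall>i \<in> {1..N}. c i < n) \<and> (\<forall>i. i \<notin> {1..N} \<longrightarrow> m i = 0 \<and> c i = 0)}"

definition V :: "nat \<Rightarrow> nat \<Rightarrow> vec set" where
  "V n N = {x. Poly_Mapping.keys x \<subseteq> basis_keys n N}"

definition scale :: "complex \<Rightarrow> vec \<Rightarrow> vec" where
  "scale a x = Poly_Mapping.map (\<lambda>z. a * z) x"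

abbreviation basis_vec :: "key \<Rightarrow> vec" where
  "basis_vec b \<equiv> Poly_Mapping.single b 1"

definition lin_ext :: "(key \<Rightarrow> vec) \<Rightarrow> vec \<Rightarrow> vec" where
  "lin_ext f x = (\<Sum>b \<in> Poly_Mapping.keys x. scale (Poly_Mapping.lookup x b) (f b))"

text \<open>Linear endomorphisms are represented by functions that are \<^const>\<open>undefined\<close>
  off \<open>V n N\<close>.\<close>

definition End_V :: "nat \<Rightarrow> nat \<Rightarrow> (vec \<Rightarrow> vec) ring" where
  "End_V n N = \<lparr>carrier = {f \<in> V n N \<rightarrow>\<^sub>E V n N.
       (\<forall>x \<in> V n N. \<forall>y \<in> V n N. f (x + y) = f x + f y) \<and>
       (\<forall>a. \<forall>x \<in> V n N. f (scale a x) = scale a (f x))},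
     mult = (\<lambda>f g. compose (V n N) f g),
     one = (\<lambda>x \<in> V n N. x),
     zero = (\<lambda>x \<in> V n N. 0),
     add = (\<lambda>f g. \<lambda>x \<in> V n N. f x + g x)\<rparr>"

text \<open>An action of the double affine Hecke algebra on \<open>V n N\<close> is a unital homomorphism of
  complex algebras to \<open>End_V n N\<close>.\<close>

definition is_daha_action ::
    "nat \<Rightarrow> nat \<Rightarrow> complex \<Rightarrow> complex \<Rightarrow> (free_elt set \<Rightarrow> vec \<Rightarrow> vec) \<Rightarrow> bool" where
  "is_daha_action n N q v \<rho> \<longleftrightarrow>
     \<rho> \<in> extensional (carrier (daha N q v)) \<and>
     \<rho> \<in> ring_hom (daha N q v) (End_V n N) \<and>
     (\<forall>a. \<rho> (daha_class N q v (const a)) = (\<lambda>x \<in> V n N. scale a x))"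

definition Y_op :: "nat \<Rightarrow> vec \<Rightarrow> vec" where
  "Y_op i = lin_ext (\<lambda>(m, c). basis_vec (m(i := m i + 1), c))"

definition Y_inv_op :: "nat \<Rightarrow> vec \<Rightarrow> vec" where
  "Y_inv_op i = lin_ext (\<lambda>(m, c). basis_vec (m(i := m i - 1), c))"

definition sY_op :: "nat \<Rightarrow> vec \<Rightarrow> vec" where
  "sY_op i = lin_ext (\<lambda>(m, c). basis_vec (m \<circ> transpose i (i+1), c))"

definition s_op :: "nat \<Rightarrow> vec \<Rightarrow> vec" where
  "s_op i = lin_ext (\<lambda>(m, c). basis_vec (m \<circ> transpose i (i+1), c \<circ> transpose i (i+1)))"

definition E_op :: "nat \<Rightarrow> nat \<Rightarrow> nat \<Rightarrow> vec \<Rightarrow> vec" \<comment> \<open>matrix unit \<open>E\<^bsub>ab\<^esub>\<close> in factor \<open>i\<close>\<close>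
  where "E_op i a b = lin_ext (\<lambda>(m, c). if c i = b then basis_vec (m, c(i := a)) else 0)"

definition R_op :: "nat \<Rightarrow> complex \<Rightarrow> nat \<Rightarrow> vec \<Rightarrow> vec" where
  "R_op n v i x =
     scale v (\<Sum>a<n. E_op i a a (E_op (i+1) a a x)) +
     (\<Sum>b<n. \<Sum>a<b. E_op i a b (E_op (i+1) b a x) + E_op i b a (E_op (i+1) a b x) +
        scale (v - inverse v) (E_op i a a (E_op (i+1) b b x)))"

text \<open>The operator \<open>(s\<^sub>i\<^sup>Y - 1) / (Y\<^sub>i / Y\<^bsub>i+1\<^esub> - 1)\<close>: the quotient is the unique Laurent
  polynomial whose product with the denominator is the numerator.\<close>

definition div_diff_op :: "nat \<Rightarrow> vec \<Rightarrow> vec" where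
  "div_diff_op i x = (THE y. Y_op i (Y_inv_op (i+1) y) - y = sY_op i x - x)"

definition T_op :: "nat \<Rightarrow> complex \<Rightarrow> nat \<Rightarrow> vec \<Rightarrow> vec" where
  "T_op n v i x = sY_op i (R_op n v i x) + scale (v - inverse v) (div_diff_op i x)"

text \<open>In the numbering \<open>e\<^bsub>nj+a\<^esub> = Y^j e\<^sub>a\<close>, factor \<open>i\<close> of the key \<open>(m, c)\<close> carries the
  vector with index \<open>n * m i + c i\<close>.\<close>

definition e_index :: "nat \<Rightarrow> nat \<Rightarrow> key \<Rightarrow> int" where
  "e_index n i b = int n * fst b i + int (snd b i)"

definition set_e_index :: "nat \<Rightarrow> nat \<Rightarrow> int \<Rightarrow> key \<Rightarrow> key" where
  "set_e_index n i k b =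
     ((fst b)(i := k div int n), (snd b)(i := nat (k mod int n)))"

definition kappa_op :: "nat \<Rightarrow> nat \<Rightarrow> vec \<Rightarrow> vec" where
  "kappa_op n i = lin_ext (\<lambda>b. basis_vec (set_e_index n i (e_index n i b - 1) b))"

definition kappa_pow :: "nat \<Rightarrow> nat \<Rightarrow> nat \<Rightarrow> int \<Rightarrow> vec \<Rightarrow> vec" where
  "kappa_pow n N i k =
     (if 0 \<le> k then kappa_op n i ^^ nat k
      else inv_into (V n N) (kappa_op n i) ^^ nat (- k))"

definition D_op :: "complex \<Rightarrow> (nat \<Rightarrow> complex) \<Rightarrow> nat \<Rightarrow> vec \<Rightarrow> vec" where
  "D_op q u i = lin_ext (\<lambda>(m, c). scale (u (c i) * q powi m i) (basis_vec (m, c)))"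

definition pi_op :: "nat \<Rightarrow> nat \<Rightarrow> complex \<Rightarrow> (nat \<Rightarrow> complex) \<Rightarrow> int \<Rightarrow> vec \<Rightarrow> vec" where
  "pi_op n N q u ntw =
     kappa_pow n N 1 ntw \<circ> D_op q u 1 \<circ> foldr (\<circ>) (map s_op [1..<N]) id"

end

theory Submission
  imports Defs
begin

text \<open>Write \<open>h = v - v\<^sup>-\<^sup>1\<close>. The divided difference gives the commutation rules
  \<open>T\<^sub>i Y\<^sub>i = Y\<^bsub>i+1\<^esub> (T\<^sub>i - h)\<close> and \<open>T\<^sub>i Y\<^bsub>i+1\<^esub> = Y\<^sub>i T\<^sub>i + h Y\<^bsub>i+1\<^esub>\<close>, whatever \<open>R\<close> is.
  They show that the set of vectors on which the quadratic or the braid relation holds is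
  stable under all \<open>Y\<^sub>j\<close> and their inverses. Since the constant tensors generate the space under
  these operators, the relations need to be checked on constant tensors only, where \<open>T\<^sub>i\<close> acts
  as \<open>R\<^bsub>i,i+1\<^esub>\<close>.

  Conjugation by \<open>\<pi>\<close> shifts the indices of \<open>T\<^sub>i\<close> and \<open>Y\<^sub>i\<close> because the cyclic permutation
  \<open>s\<^sub>1 \<dots> s\<^bsub>N-1\<^esub>\<close> does and \<open>\<kappa>\<^sub>1, D\<^sub>1\<close> do not touch the other factors. The only relation that wraps
  around is \<open>\<pi>\<^sup>2 T\<^bsub>N-1\<^esub> = T\<^sub>1 \<pi>\<^sup>2\<close>; it amounts to \<open>D\<^sub>1 D\<^sub>2\<close> and \<open>\<kappa>\<^sub>1 \<kappa>\<^sub>2\<close> commuting with \<open>T\<^sub>1\<close>, which for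
  \<open>\<kappa>\<^sub>1 \<kappa>\<^sub>2\<close> is again checked on constants.\<close>

section \<open>Linear algebra on finitely supported functions\<close>

lemma lookup_scale [simp]: "Poly_Mapping.lookup (scale a x) k = a * Poly_Mapping.lookup x k"
  by (simp add: scale_def map.rep_eq when_def)

interpretation vec: vector_space scale
  by standard (auto intro!: poly_mapping_eqI simp: lookup_add algebra_simps)

abbreviation vlin :: "(vec \<Rightarrow> vec) \<Rightarrow> bool" where
  "vlin \<equiv> Vector_Spaces.linear scale scale"

text \<open>Linear extension over an arbitrary index type: over basis keys it is
  \<open>lin_ext\<close>, over words it yields the action of the free algebra.\<close>

definition plin :: "('a \<Rightarrow> vec) \<Rightarrow> ('a \<Rightarrow>\<^sub>0 complex) \<Rightarrow> vec" where
  "plin f x = (\<Sum>b \<in> Poly_Mapping.keys x. scale (Poly_Mapping.lookup x b) (f b))"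

lemma lin_ext_plin: "lin_ext f = plin f"
  by (simp add: fun_eq_iff lin_ext_def plin_def)

lemma plin_superset:
  assumes "finite A" "Poly_Mapping.keys x \<subseteq> A"
  shows "plin f x = (\<Sum>b\<in>A. scale (Poly_Mapping.lookup x b) (f b))"
  unfolding plin_def using assms
  by (intro sum.mono_neutral_left) (auto simp: in_keys_iff)

lemma plin_add: "plin f (x + y) = plin f x + plin f y"
proof -
  let ?A = "Poly_Mapping.keys x \<union> Poly_Mapping.keys y"
  have "Poly_Mapping.keys (x + y) \<subseteq> ?A" by (rule Poly_Mapping.keys_add)
  then show ?thesis
    by (subst (1 2 3) plin_superset[of ?A])
       (auto simp: lookup_add vec.scale_left_distrib sum.distrib)
qed

lemma plin_zero [simp]: "plin f 0 = 0"
  by (simp add: plin_def)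

lemma plin_single [simp]: "plin f (Poly_Mapping.single b a) = scale a (f b)"
  by (cases "a = 0") (simp_all add: plin_def)

lemma vlin_lin_ext [intro, simp]: "vlin (lin_ext f)"
proof -
  have "plin f (scale a x) = scale a (plin f x)" for a x
  proof -
    have "Poly_Mapping.keys (scale a x) \<subseteq> Poly_Mapping.keys x"
      by (auto simp: in_keys_iff)
    then show ?thesis
      by (subst (1 2) plin_superset[of "Poly_Mapping.keys x"]) (auto simp: vec.scale_sum_right)
  qed
  then show ?thesis
    unfolding lin_ext_plin
    by unfold_locales (auto simp: plin_add)
qed

lemma lin_ext_basis [simp]: "lin_ext f (basis_vec b) = f b"
  by (simp add: lin_ext_plin)

lemma poly_mapping_sum_single:
  fixes p :: "'a \<Rightarrow>\<^sub>0 'b :: comm_monoid_add"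
  shows "p = (\<Sum>w\<in>Poly_Mapping.keys p. Poly_Mapping.single w (Poly_Mapping.lookup p w))"
  by (rule poly_mapping_eqI)
     (auto simp: lookup_sum lookup_single when_def sum.If_cases in_keys_iff)

lemma vec_sum_basis:
  "x = (\<Sum>b\<in>Poly_Mapping.keys x. scale (Poly_Mapping.lookup x b) (basis_vec b))"
proof -
  have "scale a (basis_vec b) = Poly_Mapping.single b a" for a b
    by (rule poly_mapping_eqI) (simp add: lookup_single when_def)
  then show ?thesis using poly_mapping_sum_single[of x] by simp
qed

interpretation vecp: vector_space_pair scale scale ..

lemma vlinI:
  assumes "\<And>x y. F (x + y) = F x + F y" "\<And>a x. F (scale a x) = scale a (F x)"
  shows "vlin F"
  using assms by unfold_locales

lemma vlin_compose: "vlin F \<Longrightarrow> vlin G \<Longrightarrow> vlin (\<lambda>x. F (G x))"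
  using Vector_Spaces.linear_compose[of scale scale G scale F] by (simp add: o_def)

lemma vlin_id: "vlin (\<lambda>x. x)"
  by (rule vlinI) auto

text \<open>All finitely supported functions are covered, also those outside \<open>V n N\<close>,
  so identities between linear operators that hold on every basis vector need no membership
  hypothesis.\<close>

lemma vec_induct [case_names basis add scale]:
  assumes "\<And>m c. P (basis_vec (m, c))" "\<And>x y. P x \<Longrightarrow> P y \<Longrightarrow> P (x + y)"
    "\<And>a x. P x \<Longrightarrow> P (scale a x)"
  shows "P x"
proof -
  have "P (\<Sum>b\<in>A. scale (Poly_Mapping.lookup x b) (basis_vec b))" if "finite A" for A
    using that
  proof induction
    case empty
    \<comment> \<open>The zero vector is a basis vector scaled by 0.\<close>
    then show ?case using assms(3)[OF assms(1), of 0] by simp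
  next
    case (insert b A)
    then show ?case using assms by (cases b) (simp)
  qed
  from this[OF finite_keys, of x] show ?thesis by (simp only: vec_sum_basis[symmetric])
qed

section \<open>Elementary operators and their commutation rules\<close>

definition perm_op :: "(nat \<Rightarrow> nat) \<Rightarrow> vec \<Rightarrow> vec" where
  "perm_op p = lin_ext (\<lambda>(m, c). basis_vec (m \<circ> p, c \<circ> p))"

text \<open>Closed form for the power \<open>k\<close> of \<open>kappa_op n i\<close> on
  \<open>V n N\<close>; negative \<open>k\<close> is treated without an inverse function.\<close>

definition shift_op :: "nat \<Rightarrow> nat \<Rightarrow> int \<Rightarrow> vec \<Rightarrow> vec" where
  "shift_op n i k = lin_ext (\<lambda>b. basis_vec (set_e_index n i (e_index n i b - k) b))"

lemma Y_op_basis [simp]: "Y_op i (basis_vec (m, c)) = basis_vec (m(i := m i + 1), c)"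
  by (simp add: Y_op_def)

lemma Y_inv_op_basis [simp]: "Y_inv_op i (basis_vec (m, c)) = basis_vec (m(i := m i - 1), c)"
  by (simp add: Y_inv_op_def)

lemma sY_op_basis [simp]:
  "sY_op i (basis_vec (m, c)) = basis_vec (m \<circ> transpose i (Suc i), c)"
  by (simp add: sY_op_def)

lemma E_op_basis [simp]:
  "E_op i a b (basis_vec (m, c)) = (if c i = b then basis_vec (m, c(i := a)) else 0)"
  by (simp add: E_op_def)

lemma D_op_basis [simp]:
  "D_op q u i (basis_vec (m, c)) = scale (u (c i) * q powi m i) (basis_vec (m, c))"
  by (simp add: D_op_def)

lemma perm_op_basis [simp]: "perm_op p (basis_vec (m, c)) = basis_vec (m \<circ> p, c \<circ> p)"
  by (simp add: perm_op_def)

lemma shift_op_basis [simp]: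
  "shift_op n i k (basis_vec b) = basis_vec (set_e_index n i (e_index n i b - k) b)"
  by (simp add: shift_op_def)

lemma s_op_eq_perm_op: "s_op i = perm_op (transpose i (Suc i))"
  by (simp add: s_op_def perm_op_def)

lemma vlin_basic_ops [simp]:
  "vlin (Y_op i)" "vlin (Y_inv_op i)" "vlin (sY_op i)" "vlin (E_op i a b)"
  "vlin (D_op q u i)" "vlin (perm_op p)" "vlin (shift_op n i k)"
  by (simp_all add: Y_op_def Y_inv_op_def sY_op_def E_op_def D_op_def perm_op_def shift_op_def)

lemmas op_simps [simp] =
  vlin_basic_ops[THEN vecp.linear_add] vlin_basic_ops[THEN vecp.linear_diff]
  vlin_basic_ops[THEN vecp.linear_scale] vlin_basic_ops[THEN vecp.linear_0]

lemma basis_vec_eq_iff [simp]: "basis_vec b = basis_vec b' \<longleftrightarrow> b = b'"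
proof
  assume "basis_vec b = basis_vec b'"
  then have "Poly_Mapping.keys (basis_vec b) = Poly_Mapping.keys (basis_vec b')" by simp
  then show "b = b'" by simp
qed simp

lemma Y_op_inv [simp]: "Y_op i (Y_inv_op i x) = x" "Y_inv_op i (Y_op i x) = x"
  by (induct x rule: vec_induct; simp)+

lemma Y_op_commute:
  "Y_op i (Y_op j x) = Y_op j (Y_op i x)"
  "Y_op i (Y_inv_op j x) = Y_inv_op j (Y_op i x)"
  "Y_inv_op i (Y_inv_op j x) = Y_inv_op j (Y_inv_op i x)"
  by (induct x rule: vec_induct; simp add: fun_eq_iff)+

lemma sY_op_Y_op:
  "sY_op i (Y_op i x) = Y_op (Suc i) (sY_op i x)"
  "sY_op i (Y_op (Suc i) x) = Y_op i (sY_op i x)"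
  "sY_op i (Y_inv_op i x) = Y_inv_op (Suc i) (sY_op i x)"
  "sY_op i (Y_inv_op (Suc i) x) = Y_inv_op i (sY_op i x)"
  by (induct x rule: vec_induct; simp add: fun_eq_iff transpose_def)+

lemma sY_op_Y_op_other:
  assumes "j \<noteq> i" "j \<noteq> Suc i"
  shows "sY_op i (Y_op j x) = Y_op j (sY_op i x)"
        "sY_op i (Y_inv_op j x) = Y_inv_op j (sY_op i x)"
  using assms by (induct x rule: vec_induct; simp add: fun_eq_iff transpose_def)+

lemma E_op_commute_Y_sY:
  "E_op i a b (Y_op j x) = Y_op j (E_op i a b x)"
  "E_op i a b (Y_inv_op j x) = Y_inv_op j (E_op i a b x)"
  "E_op i a b (sY_op j x) = sY_op j (E_op i a b x)"
  by (induct x rule: vec_induct; simp)+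

lemma E_op_commute:
  assumes "i \<noteq> j"
  shows "E_op i a b (E_op j a' b' x) = E_op j a' b' (E_op i a b x)"
  using assms by (induct x rule: vec_induct; simp add: fun_upd_twist)

lemma sY_op_commute:
  assumes "j \<noteq> i" "j \<noteq> Suc i" "i \<noteq> Suc j"
  shows "sY_op i (sY_op j x) = sY_op j (sY_op i x)"
proof -
  have "transpose j (Suc j) \<circ> transpose i (Suc i) = transpose i (Suc i) \<circ> transpose j (Suc j)"
    using assms by (auto simp: fun_eq_iff transpose_def)
  then show ?thesis
    by (induct x rule: vec_induct) (simp_all add: comp_assoc)
qed

section \<open>Divided differences\<close>

lemma lookup_lin_ext_inj:
  assumes "inj g"
  shows "Poly_Mapping.lookup (lin_ext (\<lambda>b. basis_vec (g b)) x) (g b) = Poly_Mapping.lookup x b"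
  unfolding lin_ext_def using assms
  by (auto simp: lookup_sum lookup_single when_def inj_eq if_distrib in_keys_iff cong: if_cong)

text \<open>The difference of two solutions is fixed under multiplication by
  \<open>Y_i / Y_{i+1}\<close>, so its support is stable under raising the exponent of
  \<open>Y_i\<close>; a nonempty finite set cannot be. This is the uniqueness required by
  \<open>THE\<close> in \<open>div_diff_op\<close>.\<close>

lemma Y_ratio_minus_one_inj:
  assumes eq: "Y_op i (Y_inv_op (Suc i) y) - y = Y_op i (Y_inv_op (Suc i) z) - z"
  shows "y = z"
proof (rule ccontr)
  define w where "w = y - z"
  \<comment> \<open>The effect of \<open>Y_i / Y_{i+1}\<close> on exponents.\<close>
  define g :: "key \<Rightarrow> key" where "g = (\<lambda>(m, c). (m(Suc i := m (Suc i) - 1, i := m i + 1), c))"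
  assume "y \<noteq> z"
  then have "Poly_Mapping.keys w \<noteq> {}" by (simp add: w_def)
  have "Y_op i (Y_inv_op (Suc i) w) = w"
    using eq by (simp add: w_def algebra_simps)
  moreover have "Y_op i (Y_inv_op (Suc i) w) = lin_ext (\<lambda>b. basis_vec (g b)) w"
    by (induct w rule: vec_induct)
       (simp_all add: g_def vlin_lin_ext[THEN vecp.linear_add] vlin_lin_ext[THEN vecp.linear_scale])
  moreover have "inj g"
    by (rule inj_on_inverseI[where g = "\<lambda>(m, c). (m(i := m i - 1, Suc i := m (Suc i) + 1), c)"])
       (auto simp: g_def fun_eq_iff)
  ultimately have shift: "Poly_Mapping.lookup w (g b) = Poly_Mapping.lookup w b" for b
    using lookup_lin_ext_inj[of g w b] by simp
  let ?M = "Max ((\<lambda>b. fst b i) ` Poly_Mapping.keys w)"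
  have "?M \<in> (\<lambda>b. fst b i) ` Poly_Mapping.keys w"
    using \<open>Poly_Mapping.keys w \<noteq> {}\<close> by (intro Max_in) auto
  then obtain b where b: "b \<in> Poly_Mapping.keys w" "fst b i = ?M" by auto
  then have "g b \<in> Poly_Mapping.keys w" by (simp add: in_keys_iff shift)
  then have "fst (g b) i \<le> ?M" by (intro Max_ge) auto
  moreover have "fst (g b) i = fst b i + 1" by (simp add: g_def split: prod.splits)
  ultimately show False using b(2) by simp
qed

text \<open>A monomial with equal exponents of \<open>Y_i\<close> and \<open>Y_{i+1}\<close> is
  fixed by the swap and has quotient 0. Divisibility survives multiplication by \<open>Y_i\<close>
  and its inverse, which lead from there to every monomial.\<close>

lemma div_diff_ex: "\<exists>y. Y_op i (Y_inv_op (Suc i) y) - y = sY_op i x - x" (is "?P x")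
proof -
  have Y: "?P (Y_op i x)" if P: "?P x" for x
  proof -
    from P obtain y where y: "Y_op i (Y_inv_op (Suc i) y) - y = sY_op i x - x" by blast
    have "Y_op i y = Y_op (Suc i) (Y_op i (Y_inv_op (Suc i) y))"
      by (simp add: Y_op_commute)
    also have "\<dots> = Y_op (Suc i) (y + (sY_op i x - x))"
      using y by (simp only: diff_eq_eq add.commute)
    \<comment> \<open>The witness comes from
      \<open>s(Y_i x) - Y_i x = Y_{i+1} (s x - x) + (Y_{i+1} - Y_i) x\<close>, whose last factor
      divided by \<open>Y_i / Y_{i+1} - 1\<close> is \<open>- Y_{i+1}\<close>.\<close>
    finally show ?thesis
      by (intro exI[of _ "Y_op (Suc i) (y - x)"]) (simp add: sY_op_Y_op)
  qed
  have Yinv: "?P (Y_inv_op i x)" if P: "?P x" for x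
  proof -
    from P obtain y where y: "Y_op i (Y_inv_op (Suc i) y) - y = sY_op i x - x" by blast
    have "Y_op i (Y_inv_op (Suc i) (Y_inv_op (Suc i) y)) = Y_inv_op (Suc i) (Y_op i (Y_inv_op (Suc i) y))"
      by (simp add: Y_op_commute)
    also have "\<dots> = Y_inv_op (Suc i) (y + (sY_op i x - x))"
      using y by (simp only: diff_eq_eq add.commute)
    \<comment> \<open>Likewise, \<open>Y_{i+1}^-1 - Y_i^-1\<close> divided by
      \<open>Y_i / Y_{i+1} - 1\<close> is \<open>Y_i^-1\<close>.\<close>
    finally show ?thesis
      by (intro exI[of _ "Y_inv_op (Suc i) y + Y_inv_op i x"])
         (simp add: sY_op_Y_op Y_op_commute(3)[of "Suc i" i])
  qed
  have monom: "?P (basis_vec (m, c))" for m c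
  proof -
    \<comment> \<open>The exponents of \<open>Y_i\<close> and \<open>Y_{i+1}\<close> differ by
      \<open>d\<close>, so \<open>d = 0\<close> is the symmetric monomial.\<close>
    let ?v = "\<lambda>d. basis_vec (m(i := m (Suc i) + d), c)"
    have "?P (?v d)" for d
    proof (induction d rule: int_induct[where k = 0])
      case base
      have "(\<lambda>a. if a = i then m (Suc i) else m a) \<circ> transpose i (Suc i) =
          (\<lambda>a. if a = i then m (Suc i) else m a)"
        by (auto simp: fun_eq_iff transpose_def)
      then show ?case by (intro exI[of _ 0]) (simp add: fun_upd_def)
    next
      case (step1 d)
      have "Y_op i (?v d) = ?v (d + 1)" by (simp add: add.assoc)
      then show ?case using Y[OF step1(2)] by (simp only:)
    next
      case (step2 d)
      have "Y_inv_op i (?v d) = ?v (d - 1)" by (simp add: add_diff_eq)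
      then show ?case using Yinv[OF step2(2)] by (simp only:)
    qed
    moreover have "?v (m i - m (Suc i)) = basis_vec (m, c)" by simp
    ultimately show ?thesis by metis
  qed
  show ?thesis
  proof (induct x rule: vec_induct)
    case (basis m c)
    show ?case by (rule monom)
  next
    case (add x x')
    then obtain y y' where "Y_op i (Y_inv_op (Suc i) y) - y = sY_op i x - x"
      "Y_op i (Y_inv_op (Suc i) y') - y' = sY_op i x' - x'" by blast
    then show ?case by (intro exI[of _ "y + y'"]) (simp only: op_simps add_diff_add)
  next
    case (scale a x)
    then obtain y where "Y_op i (Y_inv_op (Suc i) y) - y = sY_op i x - x" by blast
    then show ?case
      by (intro exI[of _ "scale a y"]) (simp only: op_simps vec.scale_right_diff_distrib[symmetric])
  qed
qed

lemma div_diff_eqI: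
  assumes "Y_op i (Y_inv_op (Suc i) y) - y = sY_op i x - x"
  shows "div_diff_op i x = y"
  unfolding div_diff_op_def
proof (rule the_equality)
  show "Y_op i (Y_inv_op (i + 1) y) - y = sY_op i x - x" using assms by simp
  fix z
  assume "Y_op i (Y_inv_op (i + 1) z) - z = sY_op i x - x"
  then have "Y_op i (Y_inv_op (Suc i) z) - z = Y_op i (Y_inv_op (Suc i) y) - y"
    using assms by simp
  then show "z = y" by (rule Y_ratio_minus_one_inj)
qed

lemma div_diff_eq:
  "Y_op i (Y_inv_op (Suc i) (div_diff_op i x)) - div_diff_op i x = sY_op i x - x"
proof -
  obtain y where y: "Y_op i (Y_inv_op (Suc i) y) - y = sY_op i x - x"
    using div_diff_ex by blast
  have "div_diff_op i x = y" by (rule div_diff_eqI[OF y])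
  with y show ?thesis by (simp only:)
qed

lemma vlin_div_diff [simp]: "vlin (div_diff_op i)"
proof (rule vlinI)
  fix x y
  have "Y_op i (Y_inv_op (Suc i) (div_diff_op i x + div_diff_op i y)) -
        (div_diff_op i x + div_diff_op i y) =
       (Y_op i (Y_inv_op (Suc i) (div_diff_op i x)) - div_diff_op i x) +
       (Y_op i (Y_inv_op (Suc i) (div_diff_op i y)) - div_diff_op i y)"
    by (simp only: op_simps add_diff_add)
  also have "\<dots> = sY_op i (x + y) - (x + y)"
    unfolding div_diff_eq by (simp only: op_simps add_diff_add)
  finally show "div_diff_op i (x + y) = div_diff_op i x + div_diff_op i y"
    by (rule div_diff_eqI)
next
  fix a x
  have "Y_op i (Y_inv_op (Suc i) (scale a (div_diff_op i x))) - scale a (div_diff_op i x) =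
      scale a (Y_op i (Y_inv_op (Suc i) (div_diff_op i x)) - div_diff_op i x)"
    by (simp only: op_simps vec.scale_right_diff_distrib)
  also have "\<dots> = sY_op i (scale a x) - scale a x"
    unfolding div_diff_eq by (simp only: op_simps vec.scale_right_diff_distrib)
  finally show "div_diff_op i (scale a x) = scale a (div_diff_op i x)"
    by (rule div_diff_eqI)
qed

lemma Y_ratio_commute:
  "Y_op i (Y_inv_op (Suc i) (Y_op j x)) = Y_op j (Y_op i (Y_inv_op (Suc i) x))"
  "Y_op i (Y_inv_op (Suc i) (Y_inv_op j x)) = Y_inv_op j (Y_op i (Y_inv_op (Suc i) x))"
  by (simp_all add: Y_op_commute(1)[of i j] Y_op_commute(2)[of j "Suc i", symmetric]
      Y_op_commute(2)[of i j] Y_op_commute(3)[of "Suc i" j])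

lemma div_diff_Y_ratio:
  "Y_op i (Y_inv_op (Suc i) (div_diff_op i x)) = div_diff_op i x + (sY_op i x - x)"
  using div_diff_eq[of i x] by (simp only: diff_eq_eq add.commute)

text \<open>The twisted Leibniz rule \<open>d(f x) = s(f) d(x) + d(f) x\<close>, where
  \<open>d\<close> takes \<open>Y_i\<close>, \<open>Y_{i+1}\<close>, \<open>Y_i^-1\<close>,
  \<open>Y_{i+1}^-1\<close> to \<open>- Y_{i+1}\<close>, \<open>Y_{i+1}\<close>,
  \<open>Y_i^-1\<close>, \<open>- Y_i^-1\<close>.\<close>

lemma div_diff_Y:
  "div_diff_op i (Y_op i x) = Y_op (Suc i) (div_diff_op i x) - Y_op (Suc i) x"
  "div_diff_op i (Y_op (Suc i) x) = Y_op i (div_diff_op i x) + Y_op (Suc i) x"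
  "div_diff_op i (Y_inv_op i x) = Y_inv_op (Suc i) (div_diff_op i x) + Y_inv_op i x"
  "div_diff_op i (Y_inv_op (Suc i) x) = Y_inv_op i (div_diff_op i x) - Y_inv_op i x"
proof -
  note [simp] = div_diff_Y_ratio sY_op_Y_op
  have x: "Y_op i (Y_inv_op (Suc i) (Y_op (Suc i) x)) = Y_op i x" by simp
  have x': "Y_op i (Y_inv_op (Suc i) (Y_inv_op i x)) = Y_inv_op (Suc i) x"
    by (simp add: Y_op_commute)
  show "div_diff_op i (Y_op i x) = Y_op (Suc i) (div_diff_op i x) - Y_op (Suc i) x"
    by (rule div_diff_eqI) (simp add: Y_ratio_commute[of i "Suc i" "div_diff_op i x"] x del: Y_op_inv)
  show "div_diff_op i (Y_op (Suc i) x) = Y_op i (div_diff_op i x) + Y_op (Suc i) x"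
    by (rule div_diff_eqI) (simp add: Y_ratio_commute[of i i "div_diff_op i x"] x)
  show "div_diff_op i (Y_inv_op i x) = Y_inv_op (Suc i) (div_diff_op i x) + Y_inv_op i x"
    by (rule div_diff_eqI) (simp add: Y_ratio_commute[of i "Suc i" "div_diff_op i x"] x')
  show "div_diff_op i (Y_inv_op (Suc i) x) = Y_inv_op i (div_diff_op i x) - Y_inv_op i x"
    by (rule div_diff_eqI) (simp add: Y_ratio_commute(2)[of i i "div_diff_op i x"] x')
qed

text \<open>\<open>F\<close> carries the defining equation of one quotient to that of the other, and
  quotients are unique.\<close>

lemma div_diff_intertwine:
  assumes "vlin F"
    and "\<And>x. F (sY_op i x) = sY_op k (F x)"
    and "\<And>x. F (Y_op i (Y_inv_op (Suc i) x)) = Y_op k (Y_inv_op (Suc k) (F x))"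
  shows "F (div_diff_op i x) = div_diff_op k (F x)"
proof (rule div_diff_eqI[symmetric])
  show "Y_op k (Y_inv_op (Suc k) (F (div_diff_op i x))) - F (div_diff_op i x) = sY_op k (F x) - F x"
    by (simp add: assms(2,3)[symmetric] div_diff_Y_ratio vecp.linear_add[OF assms(1)]
        vecp.linear_diff[OF assms(1)])
qed

section \<open>The operators \<open>T\<^sub>i\<close>\<close>

lemma R_op_intertwine:
  assumes F: "vlin F"
    and "\<And>a b x. F (E_op i a b x) = E_op k a b (F x)"
    and "\<And>a b x. F (E_op (Suc i) a b x) = E_op (Suc k) a b (F x)"
  shows "F (R_op n v i x) = R_op n v k (F x)"
  by (simp add: R_op_def vecp.linear_add[OF F] vecp.linear_sum[OF F] vecp.linear_scale[OF F] assms(2,3))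

lemma vlin_R_op [simp]: "vlin (R_op n v i)"
  by (rule vlinI)
     (simp_all add: R_op_def sum.distrib vec.scale_right_distrib vec.scale_sum_right mult.commute)

lemma R_op_Y_sY:
  "R_op n v i (Y_op j x) = Y_op j (R_op n v i x)"
  "R_op n v i (Y_inv_op j x) = Y_inv_op j (R_op n v i x)"
  "R_op n v i (sY_op j x) = sY_op j (R_op n v i x)"
  by (rule R_op_intertwine[symmetric]; simp add: E_op_commute_Y_sY)+

text \<open>On a basis tensor each of the sums in \<open>R\<close> has at most one nonzero term,
  selected by the order of the two colours.\<close>

lemma R_op_basis:
  assumes "c i < n" "c (Suc i) < n"
  shows "R_op n v i (basis_vec (m, c)) =
    (if c i = c (Suc i) then scale v (basis_vec (m, c))
     else basis_vec (m, c \<circ> transpose i (Suc i)) +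
       (if c i < c (Suc i) then scale (v - inverse v) (basis_vec (m, c)) else 0))"
proof -
  let ?e = "basis_vec (m, c)" and ?s = "basis_vec (m, c \<circ> transpose i (Suc i))"
  have diag: "E_op i a a (E_op (Suc i) b b ?e) =
      (if c (Suc i) = b then if c i = a then ?e else 0 else 0)" for a b
    by (auto simp: fun_upd_idem)
  have flip: "E_op i a b (E_op (Suc i) b a ?e) =
      (if c i = b then if c (Suc i) = a then ?s else 0 else 0)" for a b
    by (auto simp: fun_eq_iff transpose_def)
  have flip': "E_op i b a (E_op (Suc i) a b ?e) =
      (if c (Suc i) = b then if c i = a then ?s else 0 else 0)" for a b
    by (auto simp: flip)
  \<comment> \<open>The conditions above are nested, not conjoined, so that the inner and then the
    outer sum collapses by \<open>push\<close> and \<open>delta\<close>.\<close>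
  have delta: "(\<Sum>a<k. if p = a then f a else 0) = (if p < k then f p else (0::vec))" for k p :: nat and f
    by (simp add: sum.delta')
  have push: "(\<Sum>a<k. if P then f a else 0) = (if P then \<Sum>a<k. f a else (0::vec))" for k :: nat and P f
    by simp
  have scale_if: "scale z (if P then w else 0) = (if P then scale z w else 0)" for P z w
    by simp
  have "(\<Sum>a<n. E_op i a a (E_op (Suc i) a a ?e)) = (if c i = c (Suc i) then ?e else 0)"
    using assms by (simp add: diag delta del: E_op_basis)
  moreover have "(\<Sum>b<n. \<Sum>a<b. E_op i a b (E_op (Suc i) b a ?e)) = (if c (Suc i) < c i then ?s else 0)"
    using assms by (simp only: flip push delta if_True)
  moreover have "(\<Sum>b<n. \<Sum>a<b. E_op i b a (E_op (Suc i) a b ?e)) = (if c i < c (Suc i) then ?s else 0)"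
    using assms by (simp only: flip' push delta if_True)
  moreover have "(\<Sum>b<n. \<Sum>a<b. scale (v - inverse v) (E_op i a a (E_op (Suc i) b b ?e))) =
      (if c i < c (Suc i) then scale (v - inverse v) ?e else 0)"
    using assms by (simp only: diag push delta scale_if if_True)
  ultimately show ?thesis
    by (auto simp: R_op_def sum.distrib simp del: E_op_basis)
qed

lemma T_op_eq: "T_op n v i x = sY_op i (R_op n v i x) + scale (v - inverse v) (div_diff_op i x)"
  by (simp add: T_op_def)

lemma vlin_T_op [simp]: "vlin (T_op n v i)"
  by (rule vlinI)
     (simp_all add: T_op_eq vecp.linear_add vecp.linear_scale vec.scale_right_distrib mult.commute)

lemmas T_op_simps [simp] = vlin_T_op[THEN vecp.linear_add] vlin_T_op[THEN vecp.linear_diff]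
  vlin_T_op[THEN vecp.linear_scale] vlin_T_op[THEN vecp.linear_0]

text \<open>The common tool for moving \<open>T_i\<close> past another operator: it suffices to
  treat \<open>R\<close>, the swap of variables and the ratio \<open>Y_i / Y_{i+1}\<close>. Allowing
  \<open>k\<close> to differ from \<open>i\<close> accommodates permutations of the factors.\<close>

lemma T_op_intertwine:
  assumes F: "vlin F"
    and "\<And>x. F (R_op n v i x) = R_op n v k (F x)"
    and "\<And>x. F (sY_op i x) = sY_op k (F x)"
    and "\<And>x. F (Y_op i (Y_inv_op (Suc i) x)) = Y_op k (Y_inv_op (Suc k) (F x))"
  shows "F (T_op n v i x) = T_op n v k (F x)"
  by (simp add: T_op_eq vecp.linear_add[OF F] vecp.linear_scale[OF F] assms(2,3)
      div_diff_intertwine[OF F assms(3,4)])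

text \<open>\<open>R\<close> commutes with multiplication by every \<open>Y_j\<close>, so the
  correction terms are those of the divided difference.\<close>

lemma T_op_Y:
  "T_op n v i (Y_op i x) = Y_op (Suc i) (T_op n v i x) - scale (v - inverse v) (Y_op (Suc i) x)"
  "T_op n v i (Y_op (Suc i) x) = Y_op i (T_op n v i x) + scale (v - inverse v) (Y_op (Suc i) x)"
  "T_op n v i (Y_inv_op i x) = Y_inv_op (Suc i) (T_op n v i x) + scale (v - inverse v) (Y_inv_op i x)"
  "T_op n v i (Y_inv_op (Suc i) x) = Y_inv_op i (T_op n v i x) - scale (v - inverse v) (Y_inv_op i x)"
  by (simp_all add: T_op_eq R_op_Y_sY sY_op_Y_op div_diff_Y vec.scale_right_diff_distrib
      vec.scale_right_distrib)

lemma T_op_Y_other: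
  assumes "j \<noteq> i" "j \<noteq> Suc i"
  shows "T_op n v i (Y_op j x) = Y_op j (T_op n v i x)"
    "T_op n v i (Y_inv_op j x) = Y_inv_op j (T_op n v i x)"
  by (rule T_op_intertwine[symmetric];
      use assms in \<open>simp add: R_op_Y_sY Y_ratio_commute sY_op_Y_op_other\<close>)+

text \<open>\<open>T_i\<close> commutes with all ingredients of \<open>T_j\<close>: the matrix units
  in factors \<open>j\<close> and \<open>j+1\<close>, the swap of these variables, and the variables
  themselves.\<close>

lemma T_op_commute:
  assumes "i \<noteq> j" "j \<noteq> Suc i" "i \<noteq> Suc j"
  shows "T_op n v i (T_op n v j x) = T_op n v j (T_op n v i x)"
proof (rule T_op_intertwine)
  have E: "T_op n v i (E_op k a b x) = E_op k a b (T_op n v i x)" if "k = j \<or> k = Suc j" for k a b x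
    using that assms
    by (intro T_op_intertwine[symmetric] R_op_intertwine)
       (auto simp: E_op_commute E_op_commute_Y_sY)
  show "T_op n v i (R_op n v j x) = R_op n v j (T_op n v i x)" for x
    by (rule R_op_intertwine) (simp_all add: E)
  show "T_op n v i (sY_op j x) = sY_op j (T_op n v i x)" for x
    using assms
    by (intro T_op_intertwine[symmetric])
       (auto simp: R_op_Y_sY sY_op_commute sY_op_Y_op_other)
qed (use assms in \<open>simp_all add: T_op_Y_other\<close>)

text \<open>Equal exponents make the monomial symmetric, so the divided difference vanishes and only
  \<open>R\<close> is left.\<close>

lemma T_op_basis:
  assumes "c i < n" "c (Suc i) < n" "m i = m (Suc i)"
  shows "T_op n v i (basis_vec (m, c)) =
    (if c i = c (Suc i) then scale v (basis_vec (m, c))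
     else basis_vec (m, c \<circ> transpose i (Suc i)) +
       (if c i < c (Suc i) then scale (v - inverse v) (basis_vec (m, c)) else 0))"
proof -
  have "m \<circ> transpose i (Suc i) = m"
    using assms(3) by (auto simp: fun_eq_iff transpose_def)
  moreover from this have "div_diff_op i (basis_vec (m, c)) = 0"
    by (intro div_diff_eqI) simp
  ultimately show ?thesis
    using assms(1,2) by (simp add: T_op_eq R_op_basis)
qed

section \<open>The representation space\<close>

lemma V_0 [simp]: "0 \<in> V n N"
  by (simp add: V_def)

lemma V_add [simp]: "x \<in> V n N \<Longrightarrow> y \<in> V n N \<Longrightarrow> x + y \<in> V n N"
  unfolding V_def using Poly_Mapping.keys_add[of x y] by blast

lemma V_scale [simp]: "x \<in> V n N \<Longrightarrow> scale a x \<in> V n N"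
  by (auto simp: V_def in_keys_iff subset_iff)

lemma V_uminus [simp]: "x \<in> V n N \<Longrightarrow> - x \<in> V n N"
  using V_scale[of x n N "-1"] by simp

lemma V_diff [simp]: "x \<in> V n N \<Longrightarrow> y \<in> V n N \<Longrightarrow> x - y \<in> V n N"
  using V_add[of x n N "- y"] by simp

lemma V_sum: "(\<And>a. a \<in> A \<Longrightarrow> f a \<in> V n N) \<Longrightarrow> sum f A \<in> V n N"
  by (induct A rule: infinite_finite_induct) auto

lemma basis_vec_in_V [simp]: "basis_vec b \<in> V n N \<longleftrightarrow> b \<in> basis_keys n N"
  by (simp add: V_def)

lemma V_span_induct [consumes 1, case_names basis add scale zero]:
  assumes "x \<in> V n N"
    and "\<And>m c. (m, c) \<in> basis_keys n N \<Longrightarrow> P (basis_vec (m, c))"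
    and "\<And>x y. x \<in> V n N \<Longrightarrow> y \<in> V n N \<Longrightarrow> P x \<Longrightarrow> P y \<Longrightarrow> P (x + y)"
    and "\<And>a x. x \<in> V n N \<Longrightarrow> P x \<Longrightarrow> P (scale a x)"
    and "P 0"
  shows "P x"
proof -
  have "P (\<Sum>b\<in>A. scale (Poly_Mapping.lookup x b) (basis_vec b))"
    if "finite A" "A \<subseteq> basis_keys n N" for A
    using that
  proof induction
    case empty
    then show ?case using assms(5) by simp
  next
    case (insert b A)
    then show ?case
      by (cases b) (auto simp del: intro!: assms(2-4) V_sum)
  qed
  from this[OF finite_keys, of x] assms(1) show ?thesis
    by (simp only: vec_sum_basis[symmetric] V_def mem_Collect_eq)
qed

lemma vlin_V:
  assumes "vlin F" "\<And>m c. (m, c) \<in> basis_keys n N \<Longrightarrow> F (basis_vec (m, c)) \<in> V n N" "x \<in> V n N"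
  shows "F x \<in> V n N"
  using assms(3)
  by (induct rule: V_span_induct)
     (simp_all add: assms vecp.linear_add vecp.linear_scale vecp.linear_0)

lemma Y_op_in_V [simp]: "i \<in> {1..N} \<Longrightarrow> x \<in> V n N \<Longrightarrow> Y_op i x \<in> V n N"
  by (rule vlin_V[of "Y_op i"]) (auto simp: basis_keys_def)

lemma Y_inv_op_in_V [simp]: "i \<in> {1..N} \<Longrightarrow> x \<in> V n N \<Longrightarrow> Y_inv_op i x \<in> V n N"
  by (rule vlin_V[of "Y_inv_op i"]) (auto simp: basis_keys_def)

text \<open>The constant tensors generate \<open>V n N\<close> under addition, scaling and
  multiplication by the variables and their inverses. The relations that depend on the shape of
  \<open>R\<close> are proved with this rule.\<close>

lemma V_Laurent_induct [consumes 1, case_names const add scale zero Y Y_inv]: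
  assumes "x \<in> V n N"
    and const: "\<And>c. (\<lambda>_. 0, c) \<in> basis_keys n N \<Longrightarrow> P (basis_vec (\<lambda>_. 0, c))"
    and "\<And>x y. x \<in> V n N \<Longrightarrow> y \<in> V n N \<Longrightarrow> P x \<Longrightarrow> P y \<Longrightarrow> P (x + y)"
    and "\<And>a x. x \<in> V n N \<Longrightarrow> P x \<Longrightarrow> P (scale a x)"
    and zero: "P 0"
    and Y: "\<And>i x. i \<in> {1..N} \<Longrightarrow> x \<in> V n N \<Longrightarrow> P x \<Longrightarrow> P (Y_op i x)"
    and Y_inv: "\<And>i x. i \<in> {1..N} \<Longrightarrow> x \<in> V n N \<Longrightarrow> P x \<Longrightarrow> P (Y_inv_op i x)"
  shows "P x"
  using assms(1)
proof (induct rule: V_span_induct)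
  case (basis m c)
  \<comment> \<open>\<open>A\<close> contains the variables that may occur; one variable is added at
    a time, its exponent moving from 0 upwards and downwards.\<close>
  have monom: "P (basis_vec (m, c))"
    if "finite A" "A \<subseteq> {1..N}" "(m, c) \<in> basis_keys n N" "\<And>i. i \<notin> A \<Longrightarrow> m i = 0" for m A
    using that
  proof (induction A arbitrary: m)
    case empty
    then have "m = (\<lambda>_. 0)" by auto
    then show ?case using const empty by simp
  next
    case (insert j A)
    let ?v = "\<lambda>d. basis_vec (m(j := d), c)"
    have V: "?v d \<in> V n N" for d
      using insert.prems by (auto simp: basis_keys_def)
    have "P (?v d)" for d
    proof (induction d rule: int_induct[where k = 0])
      case base
      show ?case using insert.prems V[of 0] by (intro insert.IH) (auto simp: fun_upd_def)
    next
      case (step1 d)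
      have "Y_op j (?v d) = ?v (d + 1)" by simp
      moreover have "P (Y_op j (?v d))" using insert.prems by (intro Y[OF _ V step1(2)]) auto
      ultimately show ?case by (simp only:)
    next
      case (step2 d)
      have "Y_inv_op j (?v d) = ?v (d - 1)" by simp
      moreover have "P (Y_inv_op j (?v d))" using insert.prems by (intro Y_inv[OF _ V step2(2)]) auto
      ultimately show ?case by (simp only:)
    qed
    from this[of "m j"] show ?case by simp
  qed
  from basis show ?case
    by (intro monom[of "{1..N}"]) (auto simp: basis_keys_def)
qed (use assms(3-4) zero in auto)

text \<open>The quotient in \<open>T_i\<close> is given by a description that says nothing about
  membership; the explicit value on constants and the rules for moving \<open>T_i\<close> past the
  variables do.\<close>

lemma T_op_in_V:
  assumes "x \<in> V n N" "i \<in> {1..<N}"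
  shows "T_op n v i x \<in> V n N"
  using assms(1)
proof (induct rule: V_Laurent_induct)
  case (const c)
  have "(\<lambda>_. 0, c \<circ> transpose i (Suc i)) \<in> basis_keys n N"
    using const assms(2) by (auto simp: basis_keys_def transpose_def)
  with const assms(2) show ?case
    by (subst T_op_basis) (auto simp: basis_keys_def simp del: basis_vec_in_V
       simp: basis_vec_in_V[unfolded basis_keys_def])
next
  case (Y j x)
  then show ?case
    using assms(2) by (cases "j = i"; cases "j = Suc i") (simp_all add: T_op_Y T_op_Y_other)
next
  case (Y_inv j x)
  then show ?case
    using assms(2) by (cases "j = i"; cases "j = Suc i") (simp_all add: T_op_Y T_op_Y_other)
qed simp_all

section \<open>The quadratic and the braid relation\<close>

lemma scale_v_v: "v \<noteq> 0 \<Longrightarrow> scale v (scale v x) = scale (v - inverse v) (scale v x) + x"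
proof -
  assume "v \<noteq> 0"
  then have "v * v = (v - inverse v) * v + 1" by (simp add: algebra_simps)
  then have "scale (v * v) x = scale ((v - inverse v) * v + 1) x" by (rule arg_cong)
  then show ?thesis by (simp only: vec.scale_left_distrib vec.scale_scale vec.scale_one)
qed

text \<open>\<open>(T - v)(T + v^-1) = 0\<close> solved for the square of \<open>T\<close>, a form
  that serves as a reduction rule.\<close>

lemma T_op_quadratic:
  assumes "x \<in> V n N" "i \<in> {1..<N}" "v \<noteq> 0"
  shows "T_op n v i (T_op n v i x) = scale (v - inverse v) (T_op n v i x) + x"
proof -
  define h where "h = v - inverse v"
  note T_Y = T_op_Y[where v = v, folded h_def]
  show ?thesis
    unfolding h_def[symmetric] using assms(1)
  proof (induct rule: V_Laurent_induct)
    case (const c)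
    \<comment> \<open>A constant tensor and its swap span a space stable under \<open>T_i\<close>;
      if the two colours agree, \<open>T_i\<close> is multiplication by \<open>v\<close>, a root of
      \<open>X^2 = h X + 1\<close>.\<close>
    have "T_op n v i (basis_vec (\<lambda>_. 0, c)) = (if c i = c (Suc i) then scale v (basis_vec (\<lambda>_. 0, c))
     else basis_vec (\<lambda>_. 0, c \<circ> transpose i (Suc i)) +
       (if c i < c (Suc i) then scale h (basis_vec (\<lambda>_. 0, c)) else 0))"
      and "T_op n v i (basis_vec (\<lambda>_. 0, c \<circ> transpose i (Suc i))) =
    (if c i = c (Suc i) then scale v (basis_vec (\<lambda>_. 0, c \<circ> transpose i (Suc i)))
     else basis_vec (\<lambda>_. 0, c) +
       (if c (Suc i) < c i then scale h (basis_vec (\<lambda>_. 0, c \<circ> transpose i (Suc i))) else 0))"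
      using const assms(2) by (auto simp: T_op_basis h_def basis_keys_def comp_assoc)
    then show ?case
      using scale_v_v[OF assms(3), folded h_def]
      by (auto simp del: vec.scale_scale simp: vec.scale_right_distrib)
  next
    case (Y j x)
    then show ?case
      by (cases "j = i"; cases "j = Suc i")
         (simp_all add: T_Y T_op_Y_other algebra_simps vec.scale_right_distrib vec.scale_right_diff_distrib)
  next
    case (Y_inv j x)
    then show ?case
      by (cases "j = i"; cases "j = Suc i")
         (simp_all add: T_Y T_op_Y_other algebra_simps vec.scale_right_distrib vec.scale_right_diff_distrib)
  qed (simp_all add: vec.scale_right_distrib algebra_simps)
qed

text \<open>Moving the variables to the left leaves correction terms containing squares of
  \<open>T_i\<close> and \<open>T_{i+1}\<close>; the quadratic relation removes them.\<close>

lemma T_op_braid: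
  assumes "x \<in> V n N" "i \<in> {1..<N}" "Suc i \<in> {1..<N}" "v \<noteq> 0"
  shows "T_op n v i (T_op n v (Suc i) (T_op n v i x)) = T_op n v (Suc i) (T_op n v i (T_op n v (Suc i) x))"
proof -
  define h where "h = v - inverse v"
  note T_Y = T_op_Y[where v = v, folded h_def]
  note T_T = T_op_quadratic[OF _ assms(2,4), folded h_def] T_op_quadratic[OF _ assms(3,4), folded h_def]
  show ?thesis
    using assms(1)
  proof (induct rule: V_Laurent_induct)
    case (const c)
    define b where "b = (\<lambda>x y z. basis_vec (\<lambda>_. 0, c(i := x, Suc i := y, Suc (Suc i) := z)))"
    have T1: "T_op n v i (b x y z) = (if x = y then scale v (b x y z)
       else b y x z + (if x < y then scale h (b x y z) else 0))"
      and T2: "T_op n v (Suc i) (b x y z) = (if y = z then scale v (b x y z)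
       else b x z y + (if y < z then scale h (b x y z) else 0))"
      if "x < n" "y < n" "z < n" for x y z
    proof -
      have 1: "c(i := x, Suc i := y, Suc (Suc i) := z) \<circ> transpose i (Suc i) =
          c(i := y, Suc i := x, Suc (Suc i) := z)"
        by (auto simp: fun_eq_iff transpose_def)
      have 2: "c(i := x, Suc i := y, Suc (Suc i) := z) \<circ> transpose (Suc i) (Suc (Suc i)) =
          c(i := x, Suc i := z, Suc (Suc i) := y)"
        by (auto simp: fun_eq_iff transpose_def)
      show "T_op n v i (b x y z) = (if x = y then scale v (b x y z)
         else b y x z + (if x < y then scale h (b x y z) else 0))"
        using that by (simp add: b_def T_op_basis h_def 1)
      show "T_op n v (Suc i) (b x y z) = (if y = z then scale v (b x y z)
         else b x z y + (if y < z then scale h (b x y z) else 0))"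
        using that by (simp add: b_def T_op_basis h_def 2)
    qed
    \<comment> \<open>Only the relative order of the three colours matters.\<close>
    have "T_op n v i (T_op n v (Suc i) (T_op n v i (b x y z))) =
        T_op n v (Suc i) (T_op n v i (T_op n v (Suc i) (b x y z)))"
      if "x < n" "y < n" "z < n" for x y z
      using that
      by (cases x y rule: linorder_cases; cases y z rule: linorder_cases; cases x z rule: linorder_cases)
         (simp_all add: T1 T2 scale_v_v[OF assms(4), folded h_def] vec.scale_right_distrib
           vec.scale_left_commute[of v h] add_ac del: vec.scale_scale)
    moreover have "basis_vec (\<lambda>_. 0, c) = b (c i) (c (Suc i)) (c (Suc (Suc i)))"
      by (simp add: b_def)
    moreover have "c i < n" "c (Suc i) < n" "c (Suc (Suc i)) < n"
      using const assms(2,3) by (auto simp: basis_keys_def)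
    ultimately show ?case by metis
  next
    case (Y j x)
    consider "j = i" | "j = Suc i" | "j = Suc (Suc i)" | "j \<noteq> i" "j \<noteq> Suc i" "j \<noteq> Suc (Suc i)" by blast
    then show ?case
      using Y
      by cases (simp_all add: T_Y T_op_Y_other T_T algebra_simps vec.scale_right_distrib vec.scale_right_diff_distrib)
  next
    case (Y_inv j x)
    consider "j = i" | "j = Suc i" | "j = Suc (Suc i)" | "j \<noteq> i" "j \<noteq> Suc i" "j \<noteq> Suc (Suc i)" by blast
    then show ?case
      using Y_inv
      by cases (simp_all add: T_Y T_op_Y_other T_T algebra_simps vec.scale_right_distrib vec.scale_right_diff_distrib)
  qed simp_all
qed

section \<open>Permutations of the tensor factors\<close>

text \<open>Factor \<open>k\<close> of \<open>perm_op p x\<close> is factor \<open>p k\<close> of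
  \<open>x\<close>, hence the reversed order.\<close>

lemma perm_op_compose: "perm_op p (perm_op r x) = perm_op (r \<circ> p) x"
  by (induct x rule: vec_induct) (simp_all add: comp_def)

lemma perm_op_id [simp]: "perm_op id x = x"
  by (induct x rule: vec_induct) (simp_all add: comp_def)

lemma fun_upd_comp_inj: "inj p \<Longrightarrow> f(p k := y) \<circ> p = (f \<circ> p)(k := y)"
  by (auto simp: fun_eq_iff inj_eq)

lemma perm_op_Y:
  assumes "inj p"
  shows "perm_op p (Y_op (p k) x) = Y_op k (perm_op p x)"
    and "perm_op p (Y_inv_op (p k) x) = Y_inv_op k (perm_op p x)"
    and "perm_op p (E_op (p k) a b x) = E_op k a b (perm_op p x)"
    and "perm_op p (D_op q u (p k) x) = D_op q u k (perm_op p x)"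
  by (induct x rule: vec_induct; simp add: fun_upd_comp_inj[OF assms])+

lemma perm_op_shift:
  assumes "inj p"
  shows "perm_op p (shift_op n (p k) t x) = shift_op n k t (perm_op p x)"
  by (induct x rule: vec_induct)
     (simp_all add: fun_upd_comp_inj[OF assms] set_e_index_def e_index_def)

lemma perm_op_sY:
  assumes "inj p" "p (Suc k) = Suc (p k)"
  shows "perm_op p (sY_op (p k) x) = sY_op k (perm_op p x)"
proof -
  have "transpose (p k) (Suc (p k)) \<circ> p = p \<circ> transpose k (Suc k)"
    using assms by (auto simp: fun_eq_iff transpose_def inj_eq simp flip: assms(2))
  then show ?thesis
    by (induct x rule: vec_induct) (simp_all add: comp_assoc)
qed

lemma perm_op_T:
  assumes p: "inj p" and k: "p k = i" "p (Suc k) = Suc i"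
  shows "perm_op p (T_op n v i x) = T_op n v k (perm_op p x)"
proof (rule T_op_intertwine)
  show "perm_op p (R_op n v i x) = R_op n v k (perm_op p x)" for x
    using perm_op_Y(3)[OF p, of k] perm_op_Y(3)[OF p, of "Suc k"] k by (intro R_op_intertwine) auto
  show "perm_op p (sY_op i x) = sY_op k (perm_op p x)" for x
    using perm_op_sY[OF p, of k] k by simp
  show "perm_op p (Y_op i (Y_inv_op (Suc i) x)) = Y_op k (Y_inv_op (Suc k) (perm_op p x))" for x
    using perm_op_Y(1)[OF p, of k] perm_op_Y(2)[OF p, of "Suc k"] k by simp
qed simp

text \<open>With the convention of \<open>perm_op\<close>, the last factor moves to the front and
  every other factor one place to the right.\<close>

definition cyc :: "nat \<Rightarrow> nat \<Rightarrow> nat" where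
  "cyc N k = (if k = 1 then N else if 2 \<le> k \<and> k \<le> N then k - 1 else k)"

definition cyc_inv :: "nat \<Rightarrow> nat \<Rightarrow> nat" where
  "cyc_inv N k = (if k = N then 1 else if 1 \<le> k \<and> k < N then Suc k else k)"

lemma cyc_cyc_inv: "N \<ge> 1 \<Longrightarrow> cyc N \<circ> cyc_inv N = id" "N \<ge> 1 \<Longrightarrow> cyc_inv N \<circ> cyc N = id"
  by (auto simp: fun_eq_iff cyc_def cyc_inv_def)

lemma inj_cyc: "N \<ge> 1 \<Longrightarrow> inj (cyc N)"
  using cyc_cyc_inv(2)[of N] by (intro inj_on_inverseI[where g = "cyc_inv N"]) (simp add: fun_eq_iff)

lemma foldr_comp: "foldr (\<circ>) fs g = foldr (\<circ>) fs id \<circ> g"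
  by (induct fs) (simp_all add: comp_assoc)

lemma foldr_s_op: "N \<ge> 1 \<Longrightarrow> foldr (\<circ>) (map s_op [1..<N]) id = perm_op (cyc N)"
proof (induct N rule: nat_induct_at_least)
  case base
  have "cyc 1 = id" by (auto simp: cyc_def fun_eq_iff)
  then have "perm_op (cyc 1) x = x" for x by (simp only: perm_op_id)
  then show ?case by (simp add: fun_eq_iff)
next
  case (Suc N)
  have "foldr (\<circ>) (map s_op [1..<Suc N]) id = foldr (\<circ>) (map s_op [1..<N]) id \<circ> s_op N"
    using Suc.hyps by (simp add: foldr_comp[of _ "s_op N"])
  \<comment> \<open>The rightmost operator acts first, so its transposition is composed on the
    left.\<close>
  also have "\<dots> = perm_op (transpose N (Suc N) \<circ> cyc N)"
    unfolding Suc.hyps(2) s_op_eq_perm_op by (simp add: fun_eq_iff perm_op_compose)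
  also have "transpose N (Suc N) \<circ> cyc N = cyc (Suc N)"
    using Suc.hyps by (auto simp: fun_eq_iff cyc_def transpose_def)
  finally show ?case .
qed

section \<open>The operators \<open>D\<^sub>i\<close> and \<open>\<kappa>\<^sub>i\<close>\<close>

lemma D_op_Y: "q \<noteq> 0 \<Longrightarrow> D_op q u i (Y_op i x) = scale q (Y_op i (D_op q u i x))"
  "q \<noteq> 0 \<Longrightarrow> D_op q u i (Y_inv_op i x) = scale (inverse q) (Y_inv_op i (D_op q u i x))"
  by (induct x rule: vec_induct;
      simp add: power_int_add power_int_diff divide_inverse mult_ac vec.scale_right_distrib)+

lemma D_op_commute:
  "i \<noteq> j \<Longrightarrow> D_op q u i (Y_op j x) = Y_op j (D_op q u i x)"
  "i \<noteq> j \<Longrightarrow> D_op q u i (Y_inv_op j x) = Y_inv_op j (D_op q u i x)"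
  "i \<noteq> j \<Longrightarrow> D_op q u i (E_op j a b x) = E_op j a b (D_op q u i x)"
  "i \<noteq> j \<Longrightarrow> D_op q u i (shift_op n j t x) = shift_op n j t (D_op q u i x)"
  "i \<noteq> j \<Longrightarrow> i \<noteq> Suc j \<Longrightarrow> D_op q u i (sY_op j x) = sY_op j (D_op q u i x)"
  by (induct x rule: vec_induct; simp add: set_e_index_def e_index_def)+

lemma shift_op_commute:
  "i \<noteq> j \<Longrightarrow> shift_op n i t (Y_op j x) = Y_op j (shift_op n i t x)"
  "i \<noteq> j \<Longrightarrow> shift_op n i t (Y_inv_op j x) = Y_inv_op j (shift_op n i t x)"
  "i \<noteq> j \<Longrightarrow> shift_op n i t (E_op j a b x) = E_op j a b (shift_op n i t x)"
  "i \<noteq> j \<Longrightarrow> shift_op n i t (shift_op n j r x) = shift_op n j r (shift_op n i t x)"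
  "i \<noteq> j \<Longrightarrow> i \<noteq> Suc j \<Longrightarrow> shift_op n i t (sY_op j x) = sY_op j (shift_op n i t x)"
  by (induct x rule: vec_induct; simp add: set_e_index_def e_index_def fun_eq_iff transpose_def)+

text \<open>\<open>Y_i\<close> raises the index of factor \<open>i\<close> by \<open>n\<close>, and
  translations of the index commute; hence the same factor is allowed here, whereas
  \<open>D_i\<close> picks up \<open>q\<close>.\<close>

lemma shift_op_Y:
  assumes "n \<ge> 1"
  shows "shift_op n i t (Y_op j x) = Y_op j (shift_op n i t x)"
    and "shift_op n i t (Y_inv_op j x) = Y_inv_op j (shift_op n i t x)"
proof -
  have Y: "shift_op n i t (Y_op i x) = Y_op i (shift_op n i t x)" for x
    using assms
    by (induct x rule: vec_induct)
       (simp_all add: set_e_index_def e_index_def fun_eq_iff flip: add_diff_eq)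
  moreover have "shift_op n i t (Y_inv_op i x) = Y_inv_op i (shift_op n i t x)" for x
    using Y[of "Y_inv_op i x"] by (metis Y_op_inv)
  ultimately show "shift_op n i t (Y_op j x) = Y_op j (shift_op n i t x)"
    and "shift_op n i t (Y_inv_op j x) = Y_inv_op j (shift_op n i t x)"
    by (cases "i = j"; simp add: shift_op_commute)+
qed

lemma e_index_set_e_index: "n \<ge> 1 \<Longrightarrow> e_index n i (set_e_index n i k b) = k"
  by (simp add: set_e_index_def e_index_def)

lemma set_e_index_idem: "set_e_index n i k (set_e_index n i l b) = set_e_index n i k b"
  by (simp add: set_e_index_def)

lemma shift_op_add:
  assumes "n \<ge> 1"
  shows "shift_op n i s (shift_op n i t x) = shift_op n i (s + t) x"
  using assms
  by (induct x rule: vec_induct)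
     (simp_all add: e_index_set_e_index set_e_index_idem diff_diff_eq add.commute[of t s])

lemma div_mod_e_index:
  assumes "a < n"
  shows "(int n * k + int a) div int n = k" "(int n * k + int a) mod int n = int a"
  using assms by (simp_all add: div_pos_pos_trivial mod_pos_pos_trivial)

text \<open>Writing the index back normalises the colour modulo \<open>n\<close>, which changes
  nothing when the colour is already below \<open>n\<close>.\<close>

lemma shift_op_0:
  assumes "x \<in> V n N" "i \<in> {1..N}"
  shows "shift_op n i 0 x = x"
  using assms(1)
  by (induct rule: V_span_induct)
     (use assms(2) in \<open>simp_all add: set_e_index_def e_index_def basis_keys_def div_mod_e_index\<close>)

lemma shift_op_in_V:
  assumes "x \<in> V n N" "i \<in> {1..N}" "n \<ge> 1"
  shows "shift_op n i t x \<in> V n N"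
proof (rule vlin_V[of "shift_op n i t"])
  have "nat (k mod int n) < n" for k
    using assms(3) by (simp add: nat_less_iff)
  then show "shift_op n i t (basis_vec (m, c)) \<in> V n N" if "(m, c) \<in> basis_keys n N" for m c
    using that assms(2) by (simp add: set_e_index_def basis_keys_def)
qed (use assms(1) in simp_all)

lemma shift_op_inverse:
  assumes "x \<in> V n N" "i \<in> {1..N}" "n \<ge> 1"
  shows "shift_op n i t (shift_op n i (- t) x) = x" "shift_op n i (- t) (shift_op n i t x) = x"
  using shift_op_0[OF assms(1,2)] by (simp_all add: shift_op_add[OF assms(3)])

lemma D_op_in_V: "x \<in> V n N \<Longrightarrow> D_op q u i x \<in> V n N"
  by (rule vlin_V[of "D_op q u i"]) (simp_all)

lemma D_op_inverse:
  assumes "x \<in> V n N" "i \<in> {1..N}" "q \<noteq> 0" "\<forall>a<n. u a \<noteq> 0"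
  shows "D_op q u i (D_op (inverse q) (\<lambda>a. inverse (u a)) i x) = x"
    and "D_op (inverse q) (\<lambda>a. inverse (u a)) i (D_op q u i x) = x"
proof -
  have unit: "inverse (u (c i)) * inverse (q powi m i) * (u (c i) * q powi m i) = 1"
    if "(m, c) \<in> basis_keys n N" for m c
  proof -
    have "u (c i) \<noteq> 0" using that assms(2,4) by (auto simp: basis_keys_def)
    then have "u (c i) * q powi m i \<noteq> 0" using assms(3) by simp
    from left_inverse[OF this] show ?thesis by simp
  qed
  have unit': "u (c i) * q powi m i * (inverse (u (c i)) * inverse (q powi m i)) = 1"
    if "(m, c) \<in> basis_keys n N" for m c
    using unit[OF that] by (subst mult.commute)
  show "D_op q u i (D_op (inverse q) (\<lambda>a. inverse (u a)) i x) = x"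
    using assms(1) by (induct rule: V_span_induct) (simp_all add: power_int_inverse unit)
  show "D_op (inverse q) (\<lambda>a. inverse (u a)) i (D_op q u i x) = x"
    using assms(1)
    by (induct rule: V_span_induct) (simp_all add: power_int_inverse unit')
qed

text \<open>On \<open>V n N\<close> the shift by 1 is bijective with inverse the shift by -1, which
  identifies the \<open>inv_into\<close> in negative powers.\<close>

lemma kappa_pow_eq_shift_op:
  assumes "x \<in> V n N" "i \<in> {1..N}" "n \<ge> 1"
  shows "kappa_pow n N i t x = shift_op n i t x"
proof -
  have kappa: "kappa_op n i = shift_op n i 1"
    by (simp add: kappa_op_def shift_op_def)
  have inv: "inv_into (V n N) (kappa_op n i) y = shift_op n i (- 1) y" if "y \<in> V n N" for y
  proof (rule inv_into_f_eq)
    show "inj_on (kappa_op n i) (V n N)"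
      unfolding kappa using shift_op_inverse(2)[OF _ assms(2,3), of _ 1]
      by (intro inj_on_inverseI[where g = "shift_op n i (- 1)"])
  qed (use that assms(2,3) in \<open>simp_all add: kappa shift_op_in_V shift_op_inverse\<close>)
  have pos: "(kappa_op n i ^^ k) x = shift_op n i (int k) x" for k
    using assms
    by (induct k) (simp_all add: kappa shift_op_add shift_op_0 add.commute)
  have neg: "(inv_into (V n N) (kappa_op n i) ^^ k) x = shift_op n i (- int k) x" for k
    using assms
    by (induct k) (simp_all add: inv shift_op_in_V shift_op_add shift_op_0)
  show ?thesis
    by (auto simp: kappa_pow_def pos neg)
qed

section \<open>Paired operators \<open>D_i D_{i+1}\<close> and
  \<open>\<kappa>_i \<kappa>_{i+1}\<close> commute with \<open>T_i\<close>\<close>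

lemma D_op_D_op_T:
  assumes "q \<noteq> 0"
  shows "D_op q u i (D_op q u (Suc i) (T_op n v i x)) = T_op n v i (D_op q u i (D_op q u (Suc i) x))"
proof (rule T_op_intertwine[where F = "\<lambda>x. D_op q u i (D_op q u (Suc i) x)"])
  let ?F = "\<lambda>x. D_op q u i (D_op q u (Suc i) x)"
  show lin: "vlin ?F" by (rule vlinI) simp_all
  \<comment> \<open>The eigenvalue of \<open>?F\<close> depends symmetrically on the two colours and
    on the sum of the exponents. Single matrix units may change it, but the products occurring in
    \<open>R\<close> preserve it.\<close>
  have flip: "?F (E_op i a b (E_op (Suc i) b a x)) = E_op i a b (E_op (Suc i) b a (?F x))" for a b x
    by (induct x rule: vec_induct) (simp_all add: mult_ac)
  have diag: "?F (E_op i a a (E_op (Suc i) b b x)) = E_op i a a (E_op (Suc i) b b (?F x))" for a b x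
    by (induct x rule: vec_induct) (simp_all add: fun_upd_idem)
  show "?F (R_op n v i x) = R_op n v i (?F x)" for x
    by (simp add: R_op_def vecp.linear_add[OF lin] vecp.linear_sum[OF lin] vecp.linear_scale[OF lin] flip diag)
  show "?F (sY_op i x) = sY_op i (?F x)" for x
    by (induct x rule: vec_induct) (simp_all add: mult_ac)
  show "?F (Y_op i (Y_inv_op (Suc i) x)) = Y_op i (Y_inv_op (Suc i) (?F x))" for x
    using assms by (simp add: D_op_Y D_op_commute)
qed

text \<open>Lowering both indices keeps the order of two colours unless exactly one of them is 0.
  Then the order is reversed, and the correction term from moving \<open>T_i\<close> past the new
  inverse variable restores equality.\<close>

lemma shift_shift_T:
  assumes "x \<in> V n N" "i \<in> {1..<N}" "n \<ge> 1"
  shows "shift_op n i 1 (shift_op n (Suc i) 1 (T_op n v i x)) =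
    T_op n v i (shift_op n i 1 (shift_op n (Suc i) 1 x))"
  using assms(1)
proof (induct rule: V_Laurent_induct)
  case (const c)
  let ?F = "\<lambda>x. shift_op n i 1 (shift_op n (Suc i) 1 x)"
  define h where "h = v - inverse v"
  note T_Y = T_op_Y[where v = v, folded h_def]
  define b where "b = (\<lambda>x y. basis_vec (\<lambda>_. 0, c(i := x, Suc i := y)))"
  have T: "T_op n v i (b x y) = (if x = y then scale v (b x y)
     else b y x + (if x < y then scale h (b x y) else 0))"
    if "x < n" "y < n" for x y
  proof -
    have 1: "c(i := x, Suc i := y) \<circ> transpose i (Suc i) = c(i := y, Suc i := x)"
      by (auto simp: fun_eq_iff transpose_def)
    show ?thesis
      using that by (simp add: b_def T_op_basis h_def 1)
  qed
  \<comment> \<open>Colour 0 wraps around to \<open>n - 1\<close> with exponent -1.\<close>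
  have pred: "(int x - 1) div int n = (if x = 0 then - 1 else 0)"
    "nat ((int x - 1) mod int n) = (if x = 0 then n - 1 else x - 1)" if "x < n" for x
    using that by (auto simp: div_pos_pos_trivial mod_pos_pos_trivial div_eq_minus1
        zmod_minus1)
  have F: "?F (b x y) = (if x = 0 then Y_inv_op i else id) ((if y = 0 then Y_inv_op (Suc i) else id)
      (b (if x = 0 then n - 1 else x - 1) (if y = 0 then n - 1 else y - 1)))"
    if "x < n" "y < n" for x y
    using that by (auto simp: b_def set_e_index_def e_index_def pred fun_eq_iff)
  have "?F (T_op n v i (b x y)) = T_op n v i (?F (b x y))" if "x < n" "y < n" for x y
  proof -
    consider "x = 0" "y = 0" | "x = 0" "y > 0" | "x > 0" "y = 0" | "x > 0" "y > 0" by blast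
    then show ?thesis
      using that
      by cases (auto simp: T F T_Y Y_op_commute(3)[of "Suc i" i] vec.scale_right_distrib)
  qed
  moreover have "basis_vec (\<lambda>_. 0, c) = b (c i) (c (Suc i))"
    by (simp add: b_def)
  moreover have "c i < n" "c (Suc i) < n"
    using const assms(2) by (auto simp: basis_keys_def)
  ultimately show ?case by metis
next
  case (Y j x)
  then show ?case
    using assms(3)
    by (cases "j = i"; cases "j = Suc i") (simp_all add: T_op_Y T_op_Y_other shift_op_Y)
next
  case (Y_inv j x)
  then show ?case
    using assms(3)
    by (cases "j = i"; cases "j = Suc i") (simp_all add: T_op_Y T_op_Y_other shift_op_Y)
qed simp_all

text \<open>On \<open>V n N\<close> the paired shifts form a group generated by the shift by 1, so
  commuting with that one suffices.\<close>

lemma shift_shift_T_int: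
  assumes "x \<in> V n N" "i \<in> {1..<N}" "n \<ge> 1"
  shows "shift_op n i t (shift_op n (Suc i) t (T_op n v i x)) =
    T_op n v i (shift_op n i t (shift_op n (Suc i) t x))"
proof -
  define F where "F = (\<lambda>t x. shift_op n i t (shift_op n (Suc i) t x))"
  have i: "i \<in> {1..N}" "Suc i \<in> {1..N}" using assms(2) by auto
  have V: "F t x \<in> V n N" if "x \<in> V n N" for t x
    using that i assms(3) by (simp add: F_def shift_op_in_V)
  have add: "F s (F t x) = F (s + t) x" for s t x
    using assms(3) by (simp add: F_def shift_op_commute(4)[of "Suc i" i] shift_op_add)
  have zero: "F 0 x = x" if "x \<in> V n N" for x
    using that i by (simp add: F_def shift_op_0)
  have one: "F 1 (T_op n v i x) = T_op n v i (F 1 x)" if "x \<in> V n N" for x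
    unfolding F_def using shift_shift_T[OF that assms(2,3)] .
  have minus_one: "F (- 1) (T_op n v i x) = T_op n v i (F (- 1) x)" if "x \<in> V n N" for x
  proof -
    have "F (- 1) (T_op n v i x) = F (- 1) (T_op n v i (F 1 (F (- 1) x)))"
      using that by (simp add: add zero)
    also have "\<dots> = F (- 1) (F 1 (T_op n v i (F (- 1) x)))"
      using that V by (simp add: one)
    also have "\<dots> = T_op n v i (F (- 1) x)"
      using that V assms(2) by (simp add: add zero T_op_in_V)
    finally show ?thesis .
  qed
  have "F t (T_op n v i x) = T_op n v i (F t x)"
  proof (induct t rule: int_induct[where k = 0])
    case base
    show ?case using assms by (simp add: zero T_op_in_V)
  next
    case (step1 t)
    have "F (t + 1) (T_op n v i x) = F 1 (F t (T_op n v i x))" by (simp add: add add.commute)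
    also have "\<dots> = T_op n v i (F 1 (F t x))" by (simp add: step1 one V assms(1))
    finally show ?case by (simp add: add add.commute)
  next
    case (step2 t)
    have "F (t - 1) (T_op n v i x) = F (- 1) (F t (T_op n v i x))" by (simp add: add)
    also have "\<dots> = T_op n v i (F (- 1) (F t x))" by (simp add: step2 minus_one V assms(1))
    finally show ?case by (simp add: add)
  qed
  then show ?thesis by (simp add: F_def)
qed

section \<open>The operator \<open>\<pi>\<close>\<close>

text \<open>Agrees with \<open>pi_op\<close> on \<open>V n N\<close> but is linear on all vectors,
  since \<open>shift_op\<close> replaces the \<open>inv_into\<close> of negative powers.\<close>

definition pi_lin :: "nat \<Rightarrow> nat \<Rightarrow> complex \<Rightarrow> (nat \<Rightarrow> complex) \<Rightarrow> int \<Rightarrow> vec \<Rightarrow> vec" where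
  "pi_lin n N q u t x = shift_op n 1 t (D_op q u 1 (perm_op (cyc N) x))"

definition pi_inv_lin :: "nat \<Rightarrow> nat \<Rightarrow> complex \<Rightarrow> (nat \<Rightarrow> complex) \<Rightarrow> int \<Rightarrow> vec \<Rightarrow> vec" where
  "pi_inv_lin n N q u t x =
     perm_op (cyc_inv N) (D_op (inverse q) (\<lambda>a. inverse (u a)) 1 (shift_op n 1 (- t) x))"

lemma vlin_pi_lin [simp]: "vlin (pi_lin n N q u t)"
  by (rule vlinI) (simp_all add: pi_lin_def)

lemma vlin_pi_inv_lin [simp]: "vlin (pi_inv_lin n N q u t)"
  by (rule vlinI) (simp_all add: pi_inv_lin_def)

lemma perm_op_in_V:
  assumes "x \<in> V n N" "\<And>i. p i \<in> {1..N} \<longleftrightarrow> i \<in> {1..N}"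
  shows "perm_op p x \<in> V n N"
proof (rule vlin_V[of "perm_op p"])
  show "perm_op p (basis_vec (m, c)) \<in> V n N" if "(m, c) \<in> basis_keys n N" for m c
    using that assms(2) by (auto simp: basis_keys_def simp del: atLeastAtMost_iff)
qed (use assms(1) in simp_all)

lemma perm_op_cyc_in_V:
  assumes "x \<in> V n N" "N \<ge> 1"
  shows "perm_op (cyc N) x \<in> V n N" "perm_op (cyc_inv N) x \<in> V n N"
  using assms by (intro perm_op_in_V; auto simp: cyc_def cyc_inv_def)+

context
  fixes n N :: nat and q v :: complex and u :: "nat \<Rightarrow> complex" and t :: int
  assumes n: "n \<ge> 1" and N: "N \<ge> 1" and q: "q \<noteq> 0" and u: "\<forall>a<n. u a \<noteq> 0"
begin

lemma pi_lin_in_V: "x \<in> V n N \<Longrightarrow> pi_lin n N q u t x \<in> V n N"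
  using n N by (simp add: pi_lin_def shift_op_in_V D_op_in_V perm_op_cyc_in_V)

lemma pi_inv_lin_in_V: "x \<in> V n N \<Longrightarrow> pi_inv_lin n N q u t x \<in> V n N"
  using n N by (simp add: pi_inv_lin_def shift_op_in_V D_op_in_V perm_op_cyc_in_V)

lemma pi_op_eq_pi_lin:
  assumes "x \<in> V n N"
  shows "pi_op n N q u t x = pi_lin n N q u t x"
  using assms n N
  by (simp add: pi_op_def pi_lin_def foldr_s_op[OF N, simplified] kappa_pow_eq_shift_op
      D_op_in_V perm_op_cyc_in_V)

lemma pi_lin_inverse:
  assumes "x \<in> V n N"
  shows "pi_lin n N q u t (pi_inv_lin n N q u t x) = x"
    and "pi_inv_lin n N q u t (pi_lin n N q u t x) = x"
  using assms n N q u
  by (simp_all add: pi_lin_def pi_inv_lin_def perm_op_compose cyc_cyc_inv D_op_inverse[where n = n and N = N]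
      shift_op_inverse[where N = N] shift_op_in_V D_op_in_V perm_op_cyc_in_V)

text \<open>The factor \<open>q\<close> arises only for \<open>i = N\<close>: the last factor is
  moved to the front, where \<open>D_1\<close> meets \<open>Y_1\<close>.\<close>

lemma pi_lin_Y:
  assumes "i \<in> {1..N}"
  shows "pi_lin n N q u t (Y_op i x) =
    (if i = N then scale q (Y_op 1 (pi_lin n N q u t x)) else Y_op (i + 1) (pi_lin n N q u t x))"
proof (cases "i = N")
  case True
  then show ?thesis
    using perm_op_Y(1)[OF inj_cyc[OF N], of 1 x] n q
    by (simp add: pi_lin_def cyc_def D_op_Y shift_op_Y)
next
  case False
  then show ?thesis
    using perm_op_Y(1)[OF inj_cyc[OF N], of "Suc i" x] n assms
    by (simp add: pi_lin_def cyc_def D_op_commute shift_op_Y)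
qed

lemma pi_lin_T:
  assumes "1 \<le> i" "i + 2 \<le> N"
  shows "pi_lin n N q u t (T_op n v i x) = T_op n v (Suc i) (pi_lin n N q u t x)"
proof -
  have 1: "perm_op (cyc N) (T_op n v i x) = T_op n v (Suc i) (perm_op (cyc N) x)"
    using assms by (intro perm_op_T inj_cyc N) (auto simp: cyc_def)
  have 2: "D_op q u 1 (T_op n v (Suc i) x) = T_op n v (Suc i) (D_op q u 1 x)" for x
    using assms by (intro T_op_intertwine R_op_intertwine) (simp_all add: D_op_commute)
  have 3: "shift_op n 1 t (T_op n v (Suc i) x) = T_op n v (Suc i) (shift_op n 1 t x)" for x
    using assms by (intro T_op_intertwine R_op_intertwine) (simp_all add: shift_op_commute)
  show ?thesis by (simp only: pi_lin_def 1 2 3)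
qed

lemma pi_lin_pi_lin_T:
  assumes "x \<in> V n N" "N \<ge> 2"
  shows "pi_lin n N q u t (pi_lin n N q u t (T_op n v (N - 1) x)) =
    T_op n v 1 (pi_lin n N q u t (pi_lin n N q u t x))"
proof -
  let ?p = "cyc N \<circ> cyc N"
  have inj: "inj ?p" using inj_cyc[OF N] by (simp add: inj_compose)
  have cyc_2: "cyc N (Suc 1) = 1" using assms(2) by (simp add: cyc_def)
  \<comment> \<open>Moving the inner permutation to the right past \<open>D_1\<close> and the shift
    in factor 1 turns them into operators in factor 2.\<close>
  have square: "pi_lin n N q u t (pi_lin n N q u t x) =
    shift_op n 1 t (shift_op n (Suc 1) t (D_op q u 1 (D_op q u (Suc 1) (perm_op ?p x))))" for x
    using perm_op_Y(4)[OF inj_cyc[OF N], where k = "Suc 1"] perm_op_shift[OF inj_cyc[OF N], where k = "Suc 1"]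
    by (simp add: pi_lin_def cyc_2[simplified] perm_op_compose D_op_commute(4))
  \<comment> \<open>The square of \<open>cyc N\<close> takes 1 and 2 to \<open>N - 1\<close> and
    \<open>N\<close>, also when \<open>N = 2\<close>.\<close>
  have 1: "perm_op ?p (T_op n v (N - 1) x) = T_op n v 1 (perm_op ?p x)"
    using assms(2) by (intro perm_op_T inj) (auto simp: cyc_def)
  have "D_op q u 1 (D_op q u (Suc 1) (perm_op ?p x)) \<in> V n N"
    using assms(1) N by (simp add: D_op_in_V perm_op_cyc_in_V flip: perm_op_compose)
  from shift_shift_T_int[OF this, of 1 t v] assms(2) n show ?thesis
    by (simp only: square 1 D_op_D_op_T[OF q]) simp
qed

lemma pi_lin_funpow_T:
  assumes "1 \<le> i" "i + k < N"
  shows "(pi_lin n N q u t ^^ k) (T_op n v i x) = T_op n v (i + k) ((pi_lin n N q u t ^^ k) x)"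
  using assms(2)
proof (induct k)
  case (Suc k)
  then show ?case using assms(1) pi_lin_T[of "i + k"] by simp
qed simp

lemma pi_lin_funpow_in_V: "x \<in> V n N \<Longrightarrow> (pi_lin n N q u t ^^ k) x \<in> V n N"
  by (induct k) (simp_all add: pi_lin_in_V)

text \<open>Conjugation by \<open>\<pi>\<close> moves \<open>T\<^sub>i\<close> up to \<open>T\<^bsub>N-1\<^esub>\<close>, \<open>\<pi>\<^sup>2\<close> carries it around to \<open>T\<^sub>1\<close>,
  and the remaining powers move it back up to \<open>T\<^sub>i\<close>.\<close>

lemma pi_lin_power_N_T:
  assumes "x \<in> V n N" "i \<in> {1..<N}"
  shows "(pi_lin n N q u t ^^ N) (T_op n v i x) = T_op n v i ((pi_lin n N q u t ^^ N) x)"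
proof -
  let ?P = "pi_lin n N q u t"
  define k where "k = N - 1 - i"
  have N_eq: "N = (i - 1) + (2 + k)" and k: "i + k = N - 1" "i + k < N"
    using assms(2) by (auto simp: k_def)
  have split: "(?P ^^ N) y = (?P ^^ (i - 1)) (?P (?P ((?P ^^ k) y)))" for y
  proof -
    have "(?P ^^ N) y = (?P ^^ ((i - 1) + (2 + k))) y" using N_eq by simp
    also have "\<dots> = (?P ^^ (i - 1)) (?P (?P ((?P ^^ k) y)))"
      unfolding funpow_add by (simp add: numeral_2_eq_2)
    finally show ?thesis .
  qed
  have "(?P ^^ k) (T_op n v i x) = T_op n v (N - 1) ((?P ^^ k) x)"
    using pi_lin_funpow_T[of i k] assms(2) k by simp
  moreover have "?P (?P (T_op n v (N - 1) ((?P ^^ k) x))) = T_op n v 1 (?P (?P ((?P ^^ k) x)))"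
    using assms by (intro pi_lin_pi_lin_T pi_lin_funpow_in_V) auto
  moreover have "(?P ^^ (i - 1)) (T_op n v 1 y) = T_op n v i ((?P ^^ (i - 1)) y)" for y
    using pi_lin_funpow_T[of 1 "i - 1"] assms(2) by simp
  ultimately show ?thesis by (simp only: split)
qed

end

section \<open>The free algebra and its quotient\<close>

text \<open>Words in the \<open>single\<close> case come from the support of \<open>p\<close>, so a
  restriction on its letters remains available.\<close>

lemma poly_mapping_single_induct [case_names zero single add]:
  fixes p :: "'a \<Rightarrow>\<^sub>0 'b :: comm_monoid_add"
  assumes zero: "P 0"
    and single: "\<And>w a. w \<in> Poly_Mapping.keys p \<Longrightarrow> P (Poly_Mapping.single w a)"
    and add: "\<And>p q. P p \<Longrightarrow> P q \<Longrightarrow> P (p + q)"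
  shows "P p"
proof -
  have "P (\<Sum>w\<in>A. Poly_Mapping.single w (Poly_Mapping.lookup p w))"
    if "finite A" "A \<subseteq> Poly_Mapping.keys p" for A
    using that by induct (auto intro: assms)
  from this[OF finite_keys, of p] show ?thesis
    by (simp only: poly_mapping_sum_single[symmetric])
qed

lemma free_alg_simps [simp]:
  "mult (free_alg N) = (*)" "one (free_alg N) = 1" "zero (free_alg N) = 0" "add (free_alg N) = (+)"
  by (simp_all add: free_alg_def)

lemma carrier_free_alg:
  "p \<in> carrier (free_alg N) \<longleftrightarrow> (\<forall>w\<in>Poly_Mapping.keys p. set (letters w) \<subseteq> daha_gens N)"
  by (simp add: free_alg_def)

lemma free_alg_single:
  "set (letters w) \<subseteq> daha_gens N \<Longrightarrow> Poly_Mapping.single w a \<in> carrier (free_alg N)"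
  by (simp add: carrier_free_alg)

lemma free_alg_0 [simp]: "0 \<in> carrier (free_alg N)"
  by (simp add: carrier_free_alg)

lemma free_alg_const [simp]: "const c \<in> carrier (free_alg N)"
  by (simp add: carrier_free_alg const_def zero_word_def)

lemma free_alg_1 [simp]: "1 \<in> carrier (free_alg N)"
  using free_alg_const[of 1] by (simp add: const_def)

lemma free_alg_gen: "g \<in> daha_gens N \<Longrightarrow> gen g \<in> carrier (free_alg N)"
  by (simp add: carrier_free_alg gen_def)

lemma free_alg_add [simp]:
  "p \<in> carrier (free_alg N) \<Longrightarrow> p' \<in> carrier (free_alg N) \<Longrightarrow> p + p' \<in> carrier (free_alg N)"
  unfolding carrier_free_alg using Poly_Mapping.keys_add[of p p'] by blast

lemma free_alg_uminus [simp]: "p \<in> carrier (free_alg N) \<Longrightarrow> - p \<in> carrier (free_alg N)"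
  by (auto simp: carrier_free_alg in_keys_iff)

lemma free_alg_diff [simp]:
  "p \<in> carrier (free_alg N) \<Longrightarrow> p' \<in> carrier (free_alg N) \<Longrightarrow> p - p' \<in> carrier (free_alg N)"
  using free_alg_add[of p N "- p'"] by simp

lemma free_alg_mult [simp]:
  assumes "p \<in> carrier (free_alg N)" "p' \<in> carrier (free_alg N)"
  shows "p * p' \<in> carrier (free_alg N)"
  unfolding carrier_free_alg
proof
  fix w
  assume "w \<in> Poly_Mapping.keys (p * p')"
  then obtain w1 w2 where "w = w1 + w2" "w1 \<in> Poly_Mapping.keys p" "w2 \<in> Poly_Mapping.keys p'"
    using keys_mult[of p p'] by blast
  with assms show "set (letters w) \<subseteq> daha_gens N"
    by (auto simp: carrier_free_alg plus_word_def)
qed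

lemma free_alg_power [simp]: "p \<in> carrier (free_alg N) \<Longrightarrow> p ^ k \<in> carrier (free_alg N)"
  by (induct k) simp_all

lemma ring_free_alg: "ring (free_alg N)"
proof (rule ringI)
  show "abelian_group (free_alg N)"
  proof (rule abelian_groupI)
    show "\<exists>y\<in>carrier (free_alg N). y \<oplus>\<^bsub>free_alg N\<^esub> x = \<zero>\<^bsub>free_alg N\<^esub>"
      if "x \<in> carrier (free_alg N)" for x
      using that by (intro bexI[of _ "- x"]) simp_all
  qed (simp_all add: add_ac)
  show "Group.monoid (free_alg N)"
    by (rule Group.monoidI) (simp_all add: mult.assoc)
qed (simp_all add: algebra_simps)

lemma daha_rels_subset: "daha_rels N q v \<subseteq> carrier (free_alg N)"
  unfolding daha_rels_def
  by (auto intro!: free_alg_diff free_alg_add free_alg_mult free_alg_power free_alg_gen free_alg_const free_alg_1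
      simp: daha_gens_def)

lemma ideal_daha_ideal: "ideal (daha_ideal N q v) (free_alg N)"
  unfolding daha_ideal_def by (rule ring.genideal_ideal[OF ring_free_alg daha_rels_subset])

lemma free_alg_minus:
  assumes "p \<in> carrier (free_alg N)" "p' \<in> carrier (free_alg N)"
  shows "p \<ominus>\<^bsub>free_alg N\<^esub> p' = p - p'"
proof -
  interpret ring "free_alg N" by (rule ring_free_alg)
  have "\<ominus>\<^bsub>free_alg N\<^esub> p' = - p'"
    using assms by (intro minus_equality) simp_all
  then show ?thesis by (simp add: a_minus_def)
qed

lemma daha_class_eq_iff:
  assumes "p \<in> carrier (free_alg N)" "p' \<in> carrier (free_alg N)"
  shows "daha_class N q v p = daha_class N q v p' \<longleftrightarrow> p - p' \<in> daha_ideal N q v"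
  using ring.quotient_eq_iff_same_a_r_cos[OF ring_free_alg ideal_daha_ideal assms]
    free_alg_minus[OF assms]
  by (simp add: daha_class_def)

lemma daha_class_eqI:
  assumes "p - p' \<in> daha_rels N q v" "p \<in> carrier (free_alg N)" "p' \<in> carrier (free_alg N)"
  shows "daha_class N q v p = daha_class N q v p'"
  using assms ring.genideal_self[OF ring_free_alg daha_rels_subset]
  by (auto simp: daha_class_eq_iff daha_ideal_def)

lemma carrier_daha: "carrier (daha N q v) = daha_class N q v ` carrier (free_alg N)"
  by (auto simp: daha_def FactRing_def A_RCOSETS_def' daha_class_def)

lemma daha_class_mult:
  "p \<in> carrier (free_alg N) \<Longrightarrow> p' \<in> carrier (free_alg N) \<Longrightarrow>
    daha_class N q v p \<otimes>\<^bsub>daha N q v\<^esub> daha_class N q v p' = daha_class N q v (p * p')"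
  using ideal.rcoset_mult_add[OF ideal_daha_ideal, of p N p' q v]
  by (simp add: daha_def FactRing_def daha_class_def)

lemma daha_class_add:
  "p \<in> carrier (free_alg N) \<Longrightarrow> p' \<in> carrier (free_alg N) \<Longrightarrow>
    daha_class N q v p \<oplus>\<^bsub>daha N q v\<^esub> daha_class N q v p' = daha_class N q v (p + p')"
  using abelian_subgroup.a_rcos_sum[OF
      abelian_subgroupI3[OF ideal.axioms(1)[OF ideal_daha_ideal] ring.is_abelian_group[OF ring_free_alg]],
      of p N p' q v]
  by (simp add: daha_def FactRing_def daha_class_def)

lemma daha_class_one: "\<one>\<^bsub>daha N q v\<^esub> = daha_class N q v 1"
  by (simp add: daha_def FactRing_def daha_class_def)

section \<open>Words in the generators as operators\<close>

text \<open>The universal property of the free algebra: operators for the letters extend to all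
  elements. The rightmost letter acts first, so products become compositions.\<close>

definition act :: "(daha_gen \<Rightarrow> vec \<Rightarrow> vec) \<Rightarrow> free_elt \<Rightarrow> vec \<Rightarrow> vec" where
  "act f p x = plin (\<lambda>w. foldr f (letters w) x) p"

lemma act_single: "act f (Poly_Mapping.single w a) x = scale a (foldr f (letters w) x)"
  by (simp add: act_def)

lemma act_0 [simp]: "act f 0 x = 0"
  by (simp add: act_def)

lemma act_add [simp]: "act f (p + p') x = act f p x + act f p' x"
  by (simp add: act_def plin_add)

lemma act_diff [simp]: "act f (p - p') x = act f p x - act f p' x"
  using act_add[of f "p - p'" p' x] by simp

lemma act_const [simp]: "act f (const c) x = scale c x"
  by (simp add: const_def act_single zero_word_def)

lemma act_1 [simp]: "act f 1 x = x"
  using act_const[of f 1 x] by (simp add: const_def)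

lemma act_gen [simp]: "act f (gen g) x = f g x"
  by (simp add: gen_def act_single)

context
  fixes f :: "daha_gen \<Rightarrow> vec \<Rightarrow> vec"
  assumes f: "\<And>g. vlin (f g)"
begin

lemma vlin_foldr: "vlin (foldr f gs)"
proof (induct gs)
  case Nil
  then show ?case by (simp add: vlin_id id_def)
next
  case (Cons g gs)
  then show ?case using vlin_compose[OF f Cons] by (simp add: o_def)
qed

lemma vlin_act: "vlin (act f p)"
proof (rule vlinI)
  show "act f p (x + y) = act f p x + act f p y" for x y
    by (induct p rule: poly_mapping_single_induct)
       (simp_all add: act_single vecp.linear_add[OF vlin_foldr] vec.scale_right_distrib)
  show "act f p (scale a x) = scale a (act f p x)" for a x
    by (induct p rule: poly_mapping_single_induct)
       (simp_all add: act_single vecp.linear_scale[OF vlin_foldr] vec.scale_right_distrib mult.commute)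
qed

lemma act_mult [simp]: "act f (p * p') x = act f p (act f p' x)"
proof (induct p rule: poly_mapping_single_induct)
  case (single w a)
  show ?case
  proof (induct p' rule: poly_mapping_single_induct)
    case (single w' b)
    show ?case
      by (simp add: mult_single act_single plus_word_def vecp.linear_scale[OF vlin_foldr])
  qed (simp_all add: distrib_left vecp.linear_add[OF vlin_act] vecp.linear_0[OF vlin_act])
qed (simp_all add: distrib_right)

lemma act_power [simp]: "act f (p ^ k) x = (act f p ^^ k) x"
  by (induct k) simp_all

lemma act_in_V:
  assumes "p \<in> carrier (free_alg N)" "x \<in> V n N"
    and "\<And>g y. g \<in> daha_gens N \<Longrightarrow> y \<in> V n N \<Longrightarrow> f g y \<in> V n N"
  shows "act f p x \<in> V n N"
proof -
  have foldr: "foldr f gs x \<in> V n N" if "set gs \<subseteq> daha_gens N" for gs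
    using that by (induct gs) (auto intro: assms(2,3))
  show ?thesis
    using assms(1) unfolding act_def plin_def carrier_free_alg
    by (intro V_sum V_scale foldr) auto
qed

text \<open>Multiplying on the left preserves the annihilator since linear operators fix 0, on the
  right since \<open>V n N\<close> is stable. Thus relations need to hold on \<open>V n N\<close>
  only.\<close>

lemma ideal_act_kernel:
  assumes "\<And>g y. g \<in> daha_gens N \<Longrightarrow> y \<in> V n N \<Longrightarrow> f g y \<in> V n N"
  shows "ideal {p \<in> carrier (free_alg N). \<forall>x\<in>V n N. act f p x = 0} (free_alg N)" (is "ideal ?J _")
proof (rule idealI[OF ring_free_alg])
  show "subgroup ?J (add_monoid (free_alg N))"
  proof (rule group.subgroupI)
    show "Group.group (add_monoid (free_alg N))"
      using ring.is_abelian_group[OF ring_free_alg] by (rule abelian_group.a_group)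
    show "?J \<noteq> {}" by (auto intro: exI[of _ 0])
    show "inv\<^bsub>add_monoid (free_alg N)\<^esub> p \<in> ?J" if "p \<in> ?J" for p
    proof -
      have "inv\<^bsub>add_monoid (free_alg N)\<^esub> p = - p"
        using that free_alg_minus[of 0 N p] abelian_group.minus_eq[OF ring.is_abelian_group[OF ring_free_alg]]
        by (simp add: a_minus_def a_inv_def)
      then show ?thesis using that act_diff[of f 0 p] by simp
    qed
  qed auto
qed (auto simp: vecp.linear_0[OF vlin_act] intro: act_in_V assms)

end

section \<open>The action of the double affine Hecke algebra\<close>

fun gen_op :: "nat \<Rightarrow> nat \<Rightarrow> complex \<Rightarrow> complex \<Rightarrow> (nat \<Rightarrow> complex) \<Rightarrow> int \<Rightarrow> daha_gen \<Rightarrow> vec \<Rightarrow> vec" where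
  "gen_op n N q v u t (GT i) = T_op n v i"
| "gen_op n N q v u t GPi = pi_lin n N q u t"
| "gen_op n N q v u t GPiInv = pi_inv_lin n N q u t"
| "gen_op n N q v u t (GY i) = Y_op i"
| "gen_op n N q v u t (GYInv i) = Y_inv_op i"

lemma vlin_gen_op [simp]: "vlin (gen_op n N q v u t g)"
  by (cases g) simp_all

lemma daha_gens_iff [simp]:
  "GT i \<in> daha_gens N \<longleftrightarrow> i \<in> {1..<N}" "GPi \<in> daha_gens N" "GPiInv \<in> daha_gens N"
  "GY i \<in> daha_gens N \<longleftrightarrow> i \<in> {1..N}" "GYInv i \<in> daha_gens N \<longleftrightarrow> i \<in> {1..N}"
  by (auto simp: daha_gens_def)

lemma gen_op_in_V:
  assumes "n \<ge> 1" "N \<ge> 1" "q \<noteq> 0" "\<forall>a<n. u a \<noteq> 0" "g \<in> daha_gens N" "x \<in> V n N"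
  shows "gen_op n N q v u t g x \<in> V n N"
  using assms by (cases g) (simp_all add: T_op_in_V pi_lin_in_V pi_inv_lin_in_V)

lemma act_daha_rels:
  assumes "n \<ge> 1" "N \<ge> 1" "q \<noteq> 0" "v \<noteq> 0" "\<forall>a<n. u a \<noteq> 0" "r \<in> daha_rels N q v" "x \<in> V n N"
  shows "act (gen_op n N q v u t) r x = 0"
proof -
  let ?P = "pi_lin n N q u t" and ?P' = "pi_inv_lin n N q u t"
  note inverse = pi_lin_inverse[OF assms(1-3,5)]
  have P': "?P' x \<in> V n N" using assms by (simp add: pi_inv_lin_in_V)
  have quadratic: "act (gen_op n N q v u t) ((T i - const v) * (T i + const (inverse v))) x = 0"
    if "i \<in> {1..<N}" for i
    using T_op_quadratic[OF assms(7) that assms(4)] assms(4)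
    by (simp add: vec.scale_left_diff_distrib vec.scale_right_distrib)
  have braid: "act (gen_op n N q v u t) (T i * T (i+1) * T i - T (i+1) * T i * T (i+1)) x = 0"
    if "i \<in> {1..<N}" "i + 1 \<in> {1..<N}" for i
    using T_op_braid[OF assms(7) that(1) _ assms(4)] that by simp
  have commute: "act (gen_op n N q v u t) (T i * T j - T j * T i) x = 0"
    if "\<bar>int i - int j\<bar> > 1" for i j
  proof -
    have "T_op n v i (T_op n v j x) = T_op n v j (T_op n v i x)"
      by (rule T_op_commute) (use that in auto)
    then show ?thesis by simp
  qed
  \<comment> \<open>\<open>T_i Y_i T_i = Y_{i+1} (T_i - h) T_i\<close>, and the quadratic relation
    says \<open>(T_i - h) T_i = 1\<close>.\<close>
  have TYT: "act (gen_op n N q v u t) (T i * Y i * T i - Y (i+1)) x = 0" if "i \<in> {1..<N}" for i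
    using T_op_quadratic[OF assms(7) that assms(4)] by (simp add: T_op_Y)
  have PY: "act (gen_op n N q v u t)
      (Pi_gen * Y i * Pi_inv - const (if i = N then q else 1) * Y (if i = N then 1 else i + 1)) x = 0"
    if "i \<in> {1..N}" for i
    using assms that by (simp add: pi_lin_Y inverse)
  have PT: "act (gen_op n N q v u t) (Pi_gen * T i * Pi_inv - T (i+1)) x = 0"
    if "1 \<le> i" "i + 2 \<le> N" for i
    using assms that by (simp add: pi_lin_T inverse)
  have PNT: "act (gen_op n N q v u t) (Pi_gen ^ N * T i - T i * Pi_gen ^ N) x = 0"
    if "i \<in> {1..<N}" for i
  proof -
    have P: "act (gen_op n N q v u t) Pi_gen = ?P" by (simp add: fun_eq_iff)
    show ?thesis using assms that by (simp add: P pi_lin_power_N_T)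
  qed
  show ?thesis
    using assms(6) unfolding daha_rels_def
    by (elim UnE CollectE exE conjE insertE emptyE; (simp only: quadratic braid commute TYT PY PT PNT)?;
        simp add: inverse assms(7) T_op_Y_other Y_op_commute)
qed

lemma act_daha_ideal:
  assumes "n \<ge> 1" "N \<ge> 1" "q \<noteq> 0" "v \<noteq> 0" "\<forall>a<n. u a \<noteq> 0" "r \<in> daha_ideal N q v" "x \<in> V n N"
  shows "act (gen_op n N q v u t) r x = 0"
proof -
  let ?J = "{p \<in> carrier (free_alg N). \<forall>x\<in>V n N. act (gen_op n N q v u t) p x = 0}"
  have "ideal ?J (free_alg N)"
    using assms by (intro ideal_act_kernel gen_op_in_V) simp_all
  moreover have "daha_rels N q v \<subseteq> ?J"
    using daha_rels_subset[of N q v] act_daha_rels[OF assms(1-5)] by blast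
  ultimately have "daha_ideal N q v \<subseteq> ?J"
    unfolding daha_ideal_def by (rule ring.genideal_minimal[OF ring_free_alg])
  then show ?thesis using assms(6,7) by blast
qed

section \<open>Existence and uniqueness of the action\<close>

lemma carrier_End_V:
  "\<phi> \<in> carrier (End_V n N) \<longleftrightarrow> \<phi> \<in> V n N \<rightarrow>\<^sub>E V n N \<and>
    (\<forall>x \<in> V n N. \<forall>y \<in> V n N. \<phi> (x + y) = \<phi> x + \<phi> y) \<and>
    (\<forall>a. \<forall>x \<in> V n N. \<phi> (scale a x) = scale a (\<phi> x))"
  by (simp add: End_V_def)

text \<open>The action of the free algebra descends to the quotient because the ideal annihilates
  \<open>V n N\<close>.\<close>

lemma daha_action_exists:
  assumes "n \<ge> 1" "N \<ge> 1" "q \<noteq> 0" "v \<noteq> 0" "\<forall>a<n. u a \<noteq> 0"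
  shows "\<exists>\<rho>. is_daha_action n N q v \<rho> \<and>
    (\<forall>p \<in> carrier (free_alg N).
      \<rho> (daha_class N q v p) = restrict (act (gen_op n N q v u t) p) (V n N))"
proof -
  let ?C = "carrier (free_alg N)" and ?cl = "daha_class N q v"
  define \<phi> where "\<phi> p = restrict (act (gen_op n N q v u t) p) (V n N)" for p
  define \<rho> where "\<rho> = (\<lambda>X \<in> carrier (daha N q v). \<phi> (SOME p. p \<in> ?C \<and> X = ?cl p))"
  have act_V: "act (gen_op n N q v u t) p x \<in> V n N" if "p \<in> ?C" "x \<in> V n N" for p x
    using that assms by (intro act_in_V gen_op_in_V) simp_all
  have \<rho>: "\<rho> (?cl p) = \<phi> p" if p: "p \<in> ?C" for p
  proof -
    define p' where "p' = (SOME p'. p' \<in> ?C \<and> ?cl p = ?cl p')"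
    have p': "p' \<in> ?C \<and> ?cl p = ?cl p'"
      unfolding p'_def by (rule someI[of _ p]) (use p in simp)
    then have "p - p' \<in> daha_ideal N q v"
      using daha_class_eq_iff[OF p] by blast
    \<comment> \<open>The chosen representative does not matter: two of them differ by an element of
      the ideal.\<close>
    then have "act (gen_op n N q v u t) p x = act (gen_op n N q v u t) p' x" if "x \<in> V n N" for x
      using act_daha_ideal[OF assms _ that, of "p - p'"] by simp
    then have "\<phi> p = \<phi> p'" unfolding \<phi>_def by (rule restrict_ext)
    moreover have "\<rho> (?cl p) = \<phi> p'"
      using p by (simp add: \<rho>_def carrier_daha p'_def)
    ultimately show ?thesis by simp
  qed
  have "\<rho> \<in> ring_hom (daha N q v) (End_V n N)"
  proof (rule ring_hom_memI)
    fix X Z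
    assume X: "X \<in> carrier (daha N q v)" and Z: "Z \<in> carrier (daha N q v)"
    then obtain p p' where p: "p \<in> ?C" "X = ?cl p" and p': "p' \<in> ?C" "Z = ?cl p'"
      by (auto simp: carrier_daha)
    show "\<rho> X \<in> carrier (End_V n N)"
      using p by (auto simp: \<rho> \<phi>_def carrier_End_V act_V
          vecp.linear_add[OF vlin_act] vecp.linear_scale[OF vlin_act])
    show "\<rho> (X \<otimes>\<^bsub>daha N q v\<^esub> Z) = \<rho> X \<otimes>\<^bsub>End_V n N\<^esub> \<rho> Z"
      using p p' by (auto simp: daha_class_mult \<rho> \<phi>_def End_V_def compose_def act_V fun_eq_iff)
    show "\<rho> (X \<oplus>\<^bsub>daha N q v\<^esub> Z) = \<rho> X \<oplus>\<^bsub>End_V n N\<^esub> \<rho> Z"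
      using p p' by (auto simp: daha_class_add \<rho> \<phi>_def End_V_def fun_eq_iff)
  next
    show "\<rho> \<one>\<^bsub>daha N q v\<^esub> = \<one>\<^bsub>End_V n N\<^esub>"
      by (simp add: daha_class_one \<rho> \<phi>_def End_V_def fun_eq_iff)
  qed
  then have "is_daha_action n N q v \<rho>"
    unfolding is_daha_action_def by (simp add: \<rho>) (simp add: \<rho>_def \<phi>_def fun_eq_iff)
  then show ?thesis using \<rho> unfolding \<phi>_def by blast
qed

text \<open>The value at the inverse of \<open>\<pi>\<close> is not prescribed but forced, being a
  two-sided inverse on \<open>V n N\<close>. Multiplicativity then fixes all words and additivity
  all elements.\<close>

lemma daha_action_unique:
  assumes "is_daha_action n N q v \<rho>" "is_daha_action n N q v \<rho>'"
    and gens: "\<And>g. g \<in> daha_gens N - {GPiInv} \<Longrightarrow>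
      \<rho> (daha_class N q v (gen g)) = \<rho>' (daha_class N q v (gen g))"
  shows "\<rho> = \<rho>'"
proof -
  let ?C = "carrier (free_alg N)" and ?cl = "daha_class N q v"
  have cl: "?cl p \<in> carrier (daha N q v)" if "p \<in> ?C" for p
    using that by (simp add: carrier_daha)
  have mult: "\<sigma> (?cl (p * p')) = compose (V n N) (\<sigma> (?cl p)) (\<sigma> (?cl p'))"
    and add: "\<sigma> (?cl (p + p')) = (\<lambda>x\<in>V n N. \<sigma> (?cl p) x + \<sigma> (?cl p') x)"
    if "is_daha_action n N q v \<sigma>" "p \<in> ?C" "p' \<in> ?C" for \<sigma> p p'
    using that ring_hom_mult[of \<sigma> "daha N q v" "End_V n N" "?cl p" "?cl p'"]
      ring_hom_add[of \<sigma> "daha N q v" "End_V n N" "?cl p" "?cl p'"] cl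
    by (simp_all add: is_daha_action_def daha_class_mult daha_class_add End_V_def)
  have const: "\<sigma> (?cl (const a)) = (\<lambda>x \<in> V n N. scale a x)" if "is_daha_action n N q v \<sigma>" for \<sigma> a
    using that by (simp add: is_daha_action_def)
  have V: "\<sigma> (?cl p) \<in> V n N \<rightarrow>\<^sub>E V n N" if "is_daha_action n N q v \<sigma>" "p \<in> ?C" for \<sigma> p
    using that ring_hom_closed[of \<sigma> "daha N q v" "End_V n N" "?cl p"] cl
    by (simp add: is_daha_action_def carrier_End_V)
  have one: "\<sigma> (?cl 1) x = x" if "is_daha_action n N q v \<sigma>" "x \<in> V n N" for \<sigma> x
    using that const[of \<sigma> 1] by (simp add: const_def)
  have Pi: "Pi_gen \<in> ?C" "Pi_inv \<in> ?C"
    by (simp_all add: free_alg_gen)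
  have inverse: "\<sigma> (?cl Pi_gen) (\<sigma> (?cl Pi_inv) x) = x" "\<sigma> (?cl Pi_inv) (\<sigma> (?cl Pi_gen) x) = x"
    if "is_daha_action n N q v \<sigma>" "x \<in> V n N" for \<sigma> x
  proof -
    have "?cl (Pi_gen * Pi_inv) = ?cl 1" "?cl (Pi_inv * Pi_gen) = ?cl 1"
      by (rule daha_class_eqI; simp add: Pi daha_rels_def)+
    then show "\<sigma> (?cl Pi_gen) (\<sigma> (?cl Pi_inv) x) = x" "\<sigma> (?cl Pi_inv) (\<sigma> (?cl Pi_gen) x) = x"
      using fun_cong[OF mult[OF that(1) Pi], of x] fun_cong[OF mult[OF that(1) Pi(2,1)], of x]
        one[OF that] that(2)
      by (simp_all add: compose_def)
  qed
  have "\<rho> (?cl Pi_inv) x = \<rho>' (?cl Pi_inv) x" if "x \<in> V n N" for x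
  proof -
    have "\<rho>' (?cl Pi_inv) x \<in> V n N" using V[OF assms(2) Pi(2)] that by auto
    then have "\<rho>' (?cl Pi_inv) x = \<rho> (?cl Pi_inv) (\<rho> (?cl Pi_gen) (\<rho>' (?cl Pi_inv) x))"
      by (simp only: inverse[OF assms(1)])
    also have "\<rho> (?cl Pi_gen) = \<rho>' (?cl Pi_gen)" by (rule gens) simp
    finally show ?thesis by (simp only: inverse[OF assms(2) that])
  qed
  then have Pi_inv_eq: "\<rho> (?cl Pi_inv) = \<rho>' (?cl Pi_inv)"
    using V[OF assms(1) Pi(2)] V[OF assms(2) Pi(2)] by (intro PiE_ext)
  have gens': "\<rho> (?cl (gen g)) = \<rho>' (?cl (gen g))" if "g \<in> daha_gens N" for g
    using that gens Pi_inv_eq by (cases "g = GPiInv") auto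
  have word: "\<rho> (?cl (Poly_Mapping.single (Word gs) a)) = \<rho>' (?cl (Poly_Mapping.single (Word gs) a))"
    if "set gs \<subseteq> daha_gens N" for gs a
    using that
  proof (induct gs)
    case Nil
    \<comment> \<open>The coefficient stays with the empty word, where compatibility with scalars
      determines the value.\<close>
    have "Poly_Mapping.single (Word []) a = const a" by (simp add: const_def zero_word_def)
    then show ?case by (simp add: const[OF assms(1)] const[OF assms(2)])
  next
    case (Cons g gs)
    have "Poly_Mapping.single (Word (g # gs)) a = gen g * Poly_Mapping.single (Word gs) a"
      by (simp add: gen_def mult_single plus_word_def)
    then show ?case
      using Cons by (simp add: mult assms free_alg_gen free_alg_single gens')
  qed
  have "\<rho> (?cl p) = \<rho>' (?cl p)" if "p \<in> ?C" for p
  proof -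
    \<comment> \<open>Membership is part of the claim because additivity is available only for
      classes of elements of \<open>?C\<close>.\<close>
    have "p \<in> ?C \<and> \<rho> (?cl p) = \<rho>' (?cl p)"
    proof (rule poly_mapping_single_induct[of "\<lambda>p. p \<in> ?C \<and> \<rho> (?cl p) = \<rho>' (?cl p)"])
      show "0 \<in> ?C \<and> \<rho> (?cl 0) = \<rho>' (?cl 0)"
        using word[of "[]" 0] by simp
      show "Poly_Mapping.single w a \<in> ?C \<and>
          \<rho> (?cl (Poly_Mapping.single w a)) = \<rho>' (?cl (Poly_Mapping.single w a))"
        if "w \<in> Poly_Mapping.keys p" for w a
      proof -
        have "set (letters w) \<subseteq> daha_gens N"
          using that \<open>p \<in> ?C\<close> by (simp add: carrier_free_alg)
        then show ?thesis using word[of "letters w" a] by (simp add: free_alg_single)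
      qed
    qed (simp add: add assms)
    then show ?thesis ..
  qed
  then show ?thesis
    using assms(1,2) by (intro extensionalityI[of _ "carrier (daha N q v)"])
      (auto simp: is_daha_action_def carrier_daha)
qed

theorem theorem3p1:
  fixes n N :: nat and q v :: complex and u :: "nat \<Rightarrow> complex" and ntw :: int
  assumes "n \<ge> 1" and "N \<ge> 1"
    and "q \<noteq> 0" and "v \<noteq> 0"
    and "\<forall>a<n. u a \<noteq> 0"
  shows "\<exists>!\<rho>. is_daha_action n N q v \<rho> \<and>
    (\<forall>i \<in> {1..N}. \<rho> (daha_class N q v (Y i)) = restrict (Y_op i) (V n N)) \<and>
    (\<forall>i \<in> {1..N}. \<rho> (daha_class N q v (Yinv i)) = restrict (Y_inv_op i) (V n N)) \<and>
    (\<forall>i \<in> {1..<N}. \<rho> (daha_class N q v (T i)) = restrict (T_op n v i) (V n N)) \<and>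
    \<rho> (daha_class N q v Pi_gen) = restrict (pi_op n N q u ntw) (V n N)"
    (is "\<exists>!\<rho>. ?P \<rho>")
proof (rule ex_ex1I)
  obtain \<rho> where \<rho>: "is_daha_action n N q v \<rho>"
    "\<And>p. p \<in> carrier (free_alg N) \<Longrightarrow>
      \<rho> (daha_class N q v p) = restrict (act (gen_op n N q v u ntw) p) (V n N)"
    using daha_action_exists[OF assms] by blast
  \<comment> \<open>The restriction to \<open>V n N\<close> allows \<open>pi_op\<close> to be
    replaced by \<open>pi_lin\<close>.\<close>
  have "?P \<rho>"
    by (simp add: \<rho> free_alg_gen fun_eq_iff pi_op_eq_pi_lin[OF assms(1-3,5)])
  then show "\<exists>\<rho>. ?P \<rho>" by (rule exI[where x = \<rho>])
next
  fix \<rho> \<rho>'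
  assume P: "?P \<rho>" "?P \<rho>'"
  have "\<rho> (daha_class N q v (gen g)) = \<rho>' (daha_class N q v (gen g))"
    if "g \<in> daha_gens N - {GPiInv}" for g
    using that P by (cases g) simp_all
  then show "\<rho> = \<rho>'"
    using P by (intro daha_action_unique[of n N q v]) simp_all
qed

end
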